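(* Let $B$ be a singleton board with $n$ columns, padded with columns of height zero on the left so that $\xi_m(B)=\langle z_1,\ldots,z_n\rangle$ has only non-negative entries. For each integer $k$ let $v_k$ be the number of entries of $\xi_m(B)$ equal to $k$, and let $M$ be the greatest integer with $v_M\ne0$. Let $S$ be the set of non-negative multiples of $m$ strictly less than $M$. Let $i$ be the least non-negative integer such that either $v_i>1$, or both $v_i=1$ and $i$ is not a multiple of $m$. Then the $m$-level rook equivalence graph $G_m(B)$ is connected if and only if $v_s\ge2$ for all $s\in S$ with $s>i$.
   Context: Fix an integer $m>0$. A Ferrers board is given by a weakly increasing sequence of non-negative integers $B=(b_1,\ldots,b_n)$ of column heights (cells in column $i$, rows $1,\ldots,b_i$, of the first quadrant); prepending height-$0$ columns on the left does not change the board, and boards are compared with the same number of columns by such padding. The rows are partitioned into levels: level $t$ consists of rows $(t-1)m+1,\ldots,tm$. An $m$-level rook placement of $k$ rooks is a set of $k$ cells of $B$, no two in the same level or the same column; $r_{k,m}(B)$ is their number, and two boards are $m$-level rook equivalent if they have equal $r_{k,m}$ for all $k\ge0$. For an integer $o$, $\lfloor o\rfloor_m$ is the largest multiple of $m$ that is $\le o$. $B$ is singleton if for each $i<n$, $b_i-\lfloor b_i\rfloor_m\ne0$ implies $\lfloor b_i\rfloor_m<\lfloor b_{i+1}\rfloor_m$. The $m$-level root vector of $B$ is $\xi_m(B)=\langle 0-b_1,m-b_2,\ldots,m(n-1)-b_n\rangle$. The $m$-level rook equivalence graph $G_m(B)$ of a singleton board $B$ has as vertices all singleton boards $m$-level rook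 equivalent to $B$, and $\{B_1,B_2\}$ is an edge iff, written with the same number of columns, $B_1$ and $B_2$ differ in exactly two columns $i,j$, where $B_1$ has $k$ more cells than $B_2$ in column $i$ and $k$ fewer in column $j$, for some $k>0$. *)

theory Defs
  imports Main
begin

text \<open>A board is a list of column heights (left to right), columns indexed from 0,
rows indexed from 1. It is a Ferrers board if the heights are weakly increasing.\<close>

definition ferrers :: "nat list \<Rightarrow> bool" where
  "ferrers B \<longleftrightarrow> sorted B"

definition pad :: "nat \<Rightarrow> nat list \<Rightarrow> nat list" where
  "pad L B = replicate (L - length B) 0 @ B"

definition canon :: "nat list \<Rightarrow> nat list" where
  "canon B = dropWhile (\<lambda>x. x = 0) B"

definition cells :: "nat list \<Rightarrow> (nat \<times> nat) set" where
  "cells B = {(c, r). c < length B \<and> 1 \<le> r \<and> r \<le> B ! c}"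

text \<open>Level of row r (rows (t-1)m+1..tm form level t; here levels indexed from 0).\<close>

definition level :: "nat \<Rightarrow> nat \<Rightarrow> nat" where
  "level m r = (r - 1) div m"

definition rook_num :: "nat \<Rightarrow> nat \<Rightarrow> nat list \<Rightarrow> nat" where
  "rook_num m k B = card {P. P \<subseteq> cells B \<and> card P = k \<and> inj_on fst P
                              \<and> inj_on (\<lambda>(c, r). level m r) P}"

definition rook_equiv :: "nat \<Rightarrow> nat list \<Rightarrow> nat list \<Rightarrow> bool" where
  "rook_equiv m B1 B2 \<longleftrightarrow> (\<forall>k. rook_num m k B1 = rook_num m k B2)"

definition floor_m :: "nat \<Rightarrow> nat \<Rightarrow> nat" where
  "floor_m m b = m * (b div m)"

definition singleton_board :: "nat \<Rightarrow> nat list \<Rightarrow> bool" where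
  "singleton_board m B \<longleftrightarrow>
     (\<forall>i. i + 1 < length B \<longrightarrow> B ! i - floor_m m (B ! i) \<noteq> 0
            \<longrightarrow> floor_m m (B ! i) < floor_m m (B ! (i + 1)))"

definition root_vec :: "nat \<Rightarrow> nat list \<Rightarrow> int list" where
  "root_vec m B = map (\<lambda>j. int (m * j) - int (B ! j)) [0..<length B]"

definition rook_edge :: "nat list \<Rightarrow> nat list \<Rightarrow> bool" where
  "rook_edge B1 B2 \<longleftrightarrow>
     (let L = max (length B1) (length B2); P1 = pad L B1; P2 = pad L B2 in
      \<exists>i j k. i < L \<and> j < L \<and> i \<noteq> j \<and> (k::int) > 0
        \<and> int (P1 ! i) = int (P2 ! i) + k \<and> int (P1 ! j) = int (P2 ! j) - k
        \<and> (\<forall>l<L. l \<noteq> i \<longrightarrow> l \<noteq> j \<longrightarrow> P1 ! l = P2 ! l))"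

definition rook_graph_vertices :: "nat \<Rightarrow> nat list \<Rightarrow> nat list set" where
  "rook_graph_vertices m B =
     {C. ferrers C \<and> canon C = C \<and> singleton_board m C \<and> rook_equiv m C B}"

definition rook_graph_connected :: "nat \<Rightarrow> nat list \<Rightarrow> bool" where
  "rook_graph_connected m B \<longleftrightarrow>
     (let V = rook_graph_vertices m B in
      \<forall>x\<in>V. \<forall>y\<in>V. (\<lambda>a b. a \<in> V \<and> b \<in> V \<and> rook_edge a b)\<^sup>*\<^sup>* x y)"

end

theory Submission
  imports Defs "HOL-Computational_Algebra.Polynomial" "HOL-Library.Multiset"
begin

text \<open>The factorization theorem for singleton boards expresses the rook numbers through the
product of the $x - z_j$, so two singleton boards of equal length are rook equivalent iff their
root vectors are rearrangements of each other. A rearrangement $w$ belongs to a singleton board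
iff $w_1 = 0$ and $w_{p+1} \<le> m(\<lfloor>w_p/m\<rfloor> + 1)$, and the edges of the graph are the swaps of two
distinct entries. Such a word can climb past a multiple of $m$ only by taking that value.

If a multiple $s$ of $m$ below the maximum occurs once, no swap moves it. Its position is
nevertheless not determined when there is a smaller entry $e$ that is repeated or not a multiple
of $m$, because $e$ may be placed before or after $s$; so the graph is disconnected.

Otherwise every word is connected to the lexicographically largest one: as long as
some entry is smaller than its cap $m(\<lfloor>w_p/m\<rfloor> + 1)$ and than some later entry, there is a
swap that moves a larger entry to the left. Words without such an entry are unique.\<close>

section \<open>Root words and swaps\<close>

text \<open>The bound \<open>m * (x div m + 1)\<close> after an entry \<open>x\<close>, called its
  cap, is the least multiple of \<open>m\<close> strictly above \<open>x\<close>. A word may fall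
  freely but rises at most to the next multiple.\<close>

definition root_word :: "nat \<Rightarrow> nat list \<Rightarrow> bool" where
  "root_word m w \<longleftrightarrow> w \<noteq> [] \<and> w ! 0 = 0 \<and>
     (\<forall>p. Suc p < length w \<longrightarrow> w ! Suc p \<le> m * (w ! p div m + 1))"

text \<open>The exchanged values must differ because an edge moves a positive number of
  cells.\<close>

definition swapped :: "'a list \<Rightarrow> 'a list \<Rightarrow> bool" where
  "swapped w w' \<longleftrightarrow>
     (\<exists>a b. a < b \<and> b < length w \<and> w ! a \<noteq> w ! b \<and> w' = w[a := w ! b, b := w ! a])"

text \<open>A discrete intermediate value property: an entry below the multiple \<open>s\<close> has
  cap at most \<open>s\<close>, so the first later entry that is not below \<open>s\<close> equals
  \<open>s\<close>.\<close>

lemma root_word_crossing: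
  assumes "root_word m w" "m > 0" "a \<le> c" "c < length w" "w ! a < s" "s \<le> w ! c" "m dvd s"
  shows "\<exists>d. a < d \<and> d \<le> c \<and> w ! d = s"
  using assms(3-6)
proof (induction c rule: dec_induct)
  case base
  then show ?case by simp
next
  case (step c)
  show ?case
  proof (cases "s \<le> w ! c")
    case True
    then show ?thesis using step by (meson Suc_lessD le_SucI)
  next
    case False
    obtain q where q: "s = m * q" using assms(7) by blast
    have "w ! c div m < q"
      using False q by (metis assms(2) less_mult_imp_div_less mult.commute not_le)
    then have "m * (w ! c div m + 1) \<le> s" unfolding q by (intro mult_le_mono2) simp
    moreover have "w ! Suc c \<le> m * (w ! c div m + 1)"
      using assms(1) step.prems(1) unfolding root_word_def by blast
    ultimately have "w ! Suc c = s" using step.prems(3) by simp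
    then show ?thesis using step.hyps by (intro exI[of _ "Suc c"]) simp
  qed
qed

lemma root_word_passes:
  assumes "root_word m w" "m > 0" "c < length w" "s \<le> w ! c" "m dvd s"
  shows "\<exists>d\<le>c. w ! d = s"
proof (cases "s = 0")
  case True
  then show ?thesis using assms(1) unfolding root_word_def by blast
next
  case False
  then have "w ! 0 < s" using assms(1) unfolding root_word_def by simp
  then show ?thesis using root_word_crossing[OF assms(1,2), of 0 c s] assms(3-5) by auto
qed

text \<open>The larger value moves left. Raising an entry raises the cap of its successor, and
  lowering an entry keeps it under its own bound. So only the step into \<open>Suc p\<close> and the
  step out of \<open>r\<close> could fail, and the last two assumptions cover these.\<close>

lemma root_word_swap:
  assumes "root_word m w" and m: "m > 0" and "Suc p < r" and "r < length w" and lt: "w ! Suc p < w ! r"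
    and "w ! r \<le> m * (w ! p div m + 1)"
    and "Suc r < length w \<Longrightarrow> w ! Suc r \<le> m * (w ! Suc p div m + 1)"
  shows "root_word m (w[Suc p := w ! r, r := w ! Suc p])"
proof -
  let ?w = "w[Suc p := w ! r, r := w ! Suc p]"
  have step: "w ! Suc q \<le> m * (w ! q div m + 1)" if "Suc q < length w" for q
    using that assms(1) unfolding root_word_def by blast
  have mono: "m * (x div m + 1) \<le> m * (y div m + 1)" if "x \<le> y" for x y
    using that by (intro mult_le_mono2 add_le_mono1 div_le_mono)
  have "?w ! Suc q \<le> m * (?w ! q div m + 1)" if q: "Suc q < length w" for q
  proof -
    consider "q = r" | "Suc q = r" "q = Suc p" | "Suc q = r" "q \<noteq> Suc p" | "q = Suc p" "Suc q \<noteq> r"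
      | "q = p" | "q \<noteq> r" "Suc q \<noteq> r" "q \<noteq> Suc p" "q \<noteq> p" by blast
    then show ?thesis
    proof cases
      case 1
      then show ?thesis using q assms by simp
    next
      case 2
      have "w ! r \<le> m * (w ! r div m + 1)"
        using dividend_less_times_div[OF m, of "w ! r"] by simp
      then have "w ! Suc p \<le> m * (w ! r div m + 1)"
        using lt by simp
      then show ?thesis using 2 q by simp
    next
      case 3
      then show ?thesis using step[OF q] q assms by simp
    next
      case 4
      then have "w ! Suc q \<le> m * (w ! Suc p div m + 1)" using step[OF q] by simp
      also have "\<dots> \<le> m * (w ! r div m + 1)" using lt by (intro mono) simp
      finally show ?thesis using 4 q assms(3,4) by simp
    next
      case 5
      then show ?thesis using assms by simp
    next
      case 6
      then show ?thesis using step[OF q] by (simp add: nth_list_update)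
    qed
  qed
  then show ?thesis using assms unfolding root_word_def by auto
qed

lemma mset_swapped: "swapped w w' \<Longrightarrow> mset w' = mset w"
  unfolding swapped_def by (elim exE conjE) (simp add: mset_swap)

lemma swapped_sym: "swapped w w' \<Longrightarrow> swapped w' w"
  unfolding swapped_def
proof (elim exE conjE, intro exI conjI)
  fix a b assume ab: "a < b" "b < length w" "w ! a \<noteq> w ! b" "w' = w[a := w ! b, b := w ! a]"
  show "a < b" by fact
  show "b < length w'" "w' ! a \<noteq> w' ! b" using ab by auto
  show "w = w'[a := w' ! b, b := w' ! a]"
    using ab by (intro nth_equalityI) (auto simp: nth_list_update)
qed

section \<open>Violations and the uniqueness of words without them\<close>

definition violation :: "nat \<Rightarrow> nat list \<Rightarrow> nat \<Rightarrow> bool" where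
  "violation m w p \<longleftrightarrow> w ! Suc p < m * (w ! p div m + 1) \<and>
     (\<exists>r. Suc p < r \<and> r < length w \<and> w ! Suc p < w ! r)"

text \<open>At the first index where the words differ, both have the same cap and the same remaining
  multiset. The larger of the two entries is allowed there and occurs later in the other word, which
  gives a violation.\<close>

lemma violation_free_unique:
  assumes "root_word m w" "root_word m w'" "mset w = mset w'"
    and "\<And>p. \<not> violation m w p" "\<And>p. \<not> violation m w' p"
  shows "w = w'"
proof -
  have len: "length w = length w'" using assms(3) mset_eq_length by blast
  \<comment> \<open>Stated for an arbitrary pair of words, so that it can be used in both
    directions.\<close>
  have le: "take k w = take k w' \<Longrightarrow> k < length w \<Longrightarrow> w' ! k \<le> w ! k"
    if "root_word m w" "root_word m w'" "mset w = mset w'" "\<And>p. \<not> violation m w p"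
      "length w = length w'" for k w w'
  proof (rule ccontr)
    assume eq: "take k w = take k w'" and k: "k < length w" and "\<not> w' ! k \<le> w ! k"
    then have lt: "w ! k < w' ! k" by simp
    have "k \<noteq> 0"
      using lt that(1,2) unfolding root_word_def by (metis less_irrefl)
    then obtain p where p: "k = Suc p" by (cases k) auto
    have "w ! p = w' ! p" using eq p by (metis lessI nth_take)
    then have cap: "w' ! k \<le> m * (w ! p div m + 1)"
      using that(2,5) k p unfolding root_word_def by metis
    have "mset (drop k w) = mset (drop k w')"
      using eq that(3) by (metis add_left_cancel append_take_drop_id mset_append)
    moreover have "w' ! k \<in> set (drop k w')"
      using k that(5) by (metis Cons_nth_drop_Suc list.set_intros(1))
    ultimately have "w' ! k \<in> set (drop k w)" by (metis set_mset_mset)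
    then obtain j where j: "j < length w - k" "w ! (k + j) = w' ! k"
      by (auto simp: in_set_conv_nth)
    have "j \<noteq> 0" using j lt by (metis add_0_right less_irrefl)
    then have "violation m w p"
      unfolding violation_def using lt cap p j
      by (intro conjI exI[of _ "k + j"]) auto
    then show False using that(4) by blast
  qed
  have "take k w = take k w'" if "k \<le> length w" for k
    using that
  proof (induction k)
    case 0
    then show ?case by simp
  next
    case (Suc k)
    then have eq: "take k w = take k w'" by simp
    have "w ! k = w' ! k"
      using le[OF assms(1,2,3,4) len eq] le[OF assms(2,1) assms(3)[symmetric] assms(5) len[symmetric] eq[symmetric]]
        Suc.prems len by simp
    then show ?case using eq Suc.prems len by (simp add: take_Suc_conv_app_nth)
  qed
  from this[of "length w"] show ?thesis using len by simp
qed


section \<open>Repeated entries and the removal of violations by swaps\<close>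

lemma count_ge_2_iff:
  "2 \<le> count (mset w) s \<longleftrightarrow> (\<exists>a b. a < b \<and> b < length w \<and> w ! a = s \<and> w ! b = s)"
proof -
  let ?A = "{i. i < length w \<and> w ! i = s}"
  have "count (mset w) s = length (filter (\<lambda>x. s = x) w)"
    by (simp add: count_mset count_list_eq_length_filter)
  also have "\<dots> = card ?A"
    by (simp add: length_filter_conv_card eq_commute conj_commute)
  finally have "2 \<le> count (mset w) s \<longleftrightarrow> \<not> card ?A \<le> Suc 0" by auto
  also have "\<dots> \<longleftrightarrow> (\<exists>a\<in>?A. \<exists>b\<in>?A. a \<noteq> b)"
    by (subst card_le_Suc0_iff_eq) auto
  also have "\<dots> \<longleftrightarrow> (\<exists>a b. a < b \<and> b < length w \<and> w ! a = s \<and> w ! b = s)"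
    by (auto simp: neq_iff dest: order.strict_trans)
  finally show ?thesis .
qed

lemma count_le_1_unique:
  assumes "count (mset w) s \<le> 1" "i < length w" "j < length w" "w ! i = s" "w ! j = s"
  shows "i = j"
  using assms count_ge_2_iff[of w s] by (cases i j rule: linorder_cases) auto

text \<open>The witness is \<open>w ! Suc p\<close>. If it is a multiple of \<open>m\<close>
  strictly below the cap, it is at most \<open>w ! p\<close>, so the word has already taken this
  value at some index up to \<open>p\<close>.\<close>

lemma violation_repeated_or_nonmultiple:
  assumes "root_word m w" "m > 0" "violation m w p"
  shows "\<exists>e\<in>set w. e < m * (w ! p div m + 1) \<and> (2 \<le> count (mset w) e \<or> \<not> m dvd e)"
proof -
  let ?x = "w ! Suc p"
  have x: "?x < m * (w ! p div m + 1)" and p: "Suc p < length w"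
    using assms(3) unfolding violation_def by auto
  have "2 \<le> count (mset w) ?x" if "m dvd ?x"
  proof -
    from that obtain t where t: "?x = m * t" by (rule dvdE)
    have "t \<le> w ! p div m" using x unfolding t mult_less_cancel1 by simp
    then have "?x \<le> w ! p" unfolding t
      by (metis mult_le_mono2 order_trans times_div_less_eq_dividend)
    then obtain d where "d \<le> p" "w ! d = ?x"
      using root_word_passes[OF assms(1,2) Suc_lessD[OF p] _ \<open>m dvd ?x\<close>] by blast
    then show ?thesis using p unfolding count_ge_2_iff
      by (intro exI[of _ d] exI[of _ "Suc p"]) simp
  qed
  then show ?thesis using x p by (intro bexI[of _ ?x]) auto
qed

text \<open>An instance of the rearrangement inequality. The sum is the measure that makes moving
  larger entries to the left terminate.\<close>

lemma weighted_sum_swap_less: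
  fixes w :: "nat list"
  assumes "a < b" "b < length w" "w ! a < w ! b"
  shows "(\<Sum>j<length w. j * (w[a := w ! b, b := w ! a]) ! j) < (\<Sum>j<length w. j * w ! j)"
proof -
  let ?w = "w[a := w ! b, b := w ! a]"
  let ?R = "{..<length w} - {a, b}"
  have split: "(\<Sum>j<length w. j * u ! j) = (\<Sum>j\<in>?R. j * u ! j) + (a * u ! a + b * u ! b)" for u :: "nat list"
    using sum.subset_diff[of "{a, b}" "{..<length w}" "\<lambda>j. j * u ! j"] assms(1,2) by simp
  have rest: "(\<Sum>j\<in>?R. j * ?w ! j) = (\<Sum>j\<in>?R. j * w ! j)"
    by (rule sum.cong) auto
  have rearrange: "a * y + b * x < a * x + b * y" if "a < b" "x < y" for a b x y :: nat
  proof -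
    from \<open>a < b\<close> obtain d where "b = a + d" "0 < d" using less_imp_add_positive by metis
    moreover from \<open>x < y\<close> obtain h where "y = x + h" "0 < h" using less_imp_add_positive by metis
    ultimately show ?thesis by (simp add: algebra_simps)
  qed
  have "a * w ! b + b * w ! a < a * w ! a + b * w ! b"
    using rearrange assms(1,3) by blast
  then show ?thesis unfolding split rest using assms by simp
qed

text \<open>The condition of the theorem without extremal choices: \<open>y\<close> stands in for
  the maximum \<open>M\<close>, and \<open>e\<close> for the least index \<open>i\<close>. In this
  form it depends on the multiset only and applies to any pair of witnesses.\<close>

definition multiples_repeated :: "nat \<Rightarrow> nat multiset \<Rightarrow> bool" where
  "multiples_repeated m Z \<longleftrightarrow>
     (\<forall>s y e. m dvd s \<and> y \<in># Z \<and> s < y \<and> e \<in># Z \<and> e < s \<and> (2 \<le> count Z e \<or> \<not> m dvd e)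
        \<longrightarrow> 2 \<le> count Z s)"

lemma violation_improvable:
  assumes w: "root_word m w" and m: "m > 0" and viol: "violation m w p0"
    and rep: "multiples_repeated m (mset w)"
  shows "\<exists>w'. swapped w w' \<and> root_word m w' \<and>
           (\<Sum>j<length w'. j * w' ! j) < (\<Sum>j<length w. j * w ! j)"
proof -
  \<comment> \<open>At a violation with the largest cap, swap the value with the last larger one. If that one
    exceeds the cap \<open>C\<close>, then the step towards the second occurrence of \<open>C\<close>, or a descent
    below \<open>C\<close> after the first one, is a violation with a larger cap.\<close>
  define cap where "cap p = m * (w ! p div m + 1)" for p
  have cap_gt: "w ! p < cap p" for p
    using dividend_less_times_div[OF m, of "w ! p"] unfolding cap_def by simp
  have cap_dvd: "m dvd cap p" for p unfolding cap_def by simp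
  have cap_ge: "C < cap q" if "m dvd C" "C \<le> w ! q" for C q
    using cap_gt[of q] that by simp
  have lt_len: "p < length w" if "violation m w p" for p
    using that unfolding violation_def by auto
  have "finite {p. violation m w p}"
    by (rule finite_subset[of _ "{..<length w}"]) (use lt_len in auto)
  then have fin: "finite (cap ` {p. violation m w p})" by simp
  with viol have "Max (cap ` {p. violation m w p}) \<in> cap ` {p. violation m w p}"
    by (intro Max_in) auto
  then obtain p where p: "violation m w p" and "cap p = Max (cap ` {p. violation m w p})" by auto
  then have max: "cap q \<le> cap p" if "violation m w q" for q
    using fin that by simp
  let ?x = "w ! Suc p" and ?C = "cap p"
  have x: "?x < ?C" using p unfolding violation_def cap_def by simp
  define R where "R = {r. Suc p < r \<and> r < length w \<and> ?x < w ! r}"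
  have R: "finite R" "R \<noteq> {}" using p unfolding violation_def R_def by auto
  define r where "r = Max R"
  have r: "Suc p < r" "r < length w" "?x < w ! r" using Max_in[OF R] unfolding r_def R_def by auto
  have after: "w ! q \<le> ?x" if "r < q" "q < length w" for q
  proof (rule ccontr)
    assume "\<not> w ! q \<le> ?x"
    then have "q \<in> R" using that r unfolding R_def by simp
    then show False using Max_ge[OF R(1)] that(1) unfolding r_def by force
  qed
  show ?thesis
  proof (cases "w ! r \<le> ?C")
    case True
    \<comment> \<open>Entries after \<open>r\<close> are at most \<open>?x\<close>, hence under the
      cap of \<open>?x\<close>, which is to be placed at \<open>r\<close>.\<close>
    have "w ! Suc r \<le> m * (?x div m + 1)" if "Suc r < length w"
      using after[OF _ that] cap_gt[of "Suc p"] unfolding cap_def by simp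
    then have "root_word m (w[Suc p := w ! r, r := ?x])"
      using root_word_swap[OF w m r] True unfolding cap_def by blast
    moreover have "swapped w (w[Suc p := w ! r, r := ?x])"
      unfolding swapped_def using r by (metis less_irrefl)
    ultimately show ?thesis using weighted_sum_swap_less[OF r] by (metis length_list_update)
  next
    case False
    then have big: "?C < w ! r" by simp
    \<comment> \<open>The entry \<open>w ! r\<close> lies above the multiple \<open>?C\<close>, and
      the violation itself supplies a repeated or non-multiple entry below it.\<close>
    have "2 \<le> count (mset w) ?C"
      using violation_repeated_or_nonmultiple[OF w m p] rep big cap_dvd[of p] nth_mem[OF r(2)]
      unfolding multiples_repeated_def cap_def set_mset_mset by blast
    then obtain p1 p2 where p12: "p1 < p2" "p2 < length w" "w ! p1 = ?C" "w ! p2 = ?C"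
      unfolding count_ge_2_iff by blast
    have "p2 < r" using after[of p2] p12 x big by (metis leD less_irrefl nat_neq_iff)
    \<comment> \<open>A fall from \<open>?C\<close> or above to below \<open>?C\<close> happens
      between adjacent indices \<open>q\<close> and \<open>Suc q\<close>. The cap at
      \<open>q\<close> exceeds \<open>?C\<close> and the later \<open>w ! r\<close> is larger than
      \<open>w ! Suc q\<close>, against the maximality of \<open>?C\<close>.\<close>
    have no_drop: False if ab: "a < b" "b < r" "?C \<le> w ! a" "w ! b < ?C" for a b
    proof -
      obtain q where q: "a \<le> q" "q < b" "?C \<le> w ! q" "w ! Suc q < ?C"
      proof -
        define q where "q = (LEAST k. a < k \<and> w ! k < ?C)"
        have q: "a < q" "w ! q < ?C"
          using LeastI[of "\<lambda>k. a < k \<and> w ! k < ?C" b] ab unfolding q_def by auto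
        have "q \<le> b" unfolding q_def by (rule Least_le) (use ab in simp)
        obtain k where k: "q = Suc k" using q(1) by (cases q) auto
        have "\<not> (a < k \<and> w ! k < ?C)"
          using not_less_Least[of k "\<lambda>k. a < k \<and> w ! k < ?C"] k unfolding q_def[symmetric] by simp
        then have "?C \<le> w ! k" using ab(3) q(1) k by (metis less_Suc_eq not_le)
        then show thesis using that[of k] q \<open>q \<le> b\<close> k by simp
      qed
      have "?C < cap q" using cap_ge[OF cap_dvd q(3)] .
      moreover have "violation m w q"
        unfolding violation_def cap_def[symmetric]
        using q \<open>?C < cap q\<close> big r(2) ab(2) by (intro conjI exI[of _ r]) auto
      ultimately show False using max[of q] by simp
    qed
    show ?thesis
    proof (cases "p1 \<le> p")
      case True
      then show ?thesis using no_drop[of p1 "Suc p"] r(1) x p12(3) by simp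
    next
      case False
      \<comment> \<open>The index \<open>q\<close> precedes the second \<open>?C\<close>. Either its
        entry is below \<open>?C\<close>, a fall after \<open>p1\<close>, or its cap exceeds
        \<open>?C\<close> and the following \<open>?C\<close> is itself too small.\<close>
      obtain q where q: "p2 = Suc q" using p12(1) by (cases p2) auto
      show ?thesis
      proof (cases "w ! q < ?C")
        case True
        then have "p1 < q" using p12 q by (metis less_Suc_eq less_irrefl)
        then show ?thesis using no_drop[of p1 q] True p12(3) q \<open>p2 < r\<close> by simp
      next
        case False
        then have "?C < cap q" using cap_ge[OF cap_dvd, of p q] by simp
        moreover have "violation m w q"
          unfolding violation_def cap_def[symmetric]
          using q \<open>?C < cap q\<close> big r(2) \<open>p2 < r\<close> p12(4) by (intro conjI exI[of _ r]) auto
        ultimately show ?thesis using max[of q] by simp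
      qed
    qed
  qed
qed

definition word_step :: "nat \<Rightarrow> nat list \<Rightarrow> nat list \<Rightarrow> bool" where
  "word_step m w w' \<longleftrightarrow> root_word m w \<and> root_word m w' \<and> swapped w w'"

lemma mset_word_steps: "(word_step m)\<^sup>*\<^sup>* w w' \<Longrightarrow> mset w' = mset w"
  by (induction rule: rtranclp_induct) (auto simp: word_step_def mset_swapped)

lemma word_steps_sym: "(word_step m)\<^sup>*\<^sup>* w w' \<Longrightarrow> (word_step m)\<^sup>*\<^sup>* w' w"
  by (induction rule: rtranclp_induct)
     (auto simp: word_step_def dest: swapped_sym intro: converse_rtranclp_into_rtranclp)

text \<open>Induction on the weighted sum; a swap keeps the multiset and with it the repetition
  condition.\<close>

lemma reaches_violation_free:
  assumes "root_word m w" and "m > 0"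
    and "multiples_repeated m (mset w)"
  shows "\<exists>w'. (word_step m)\<^sup>*\<^sup>* w w' \<and> root_word m w' \<and> (\<forall>p. \<not> violation m w' p)"
  using assms
proof (induction "\<Sum>j<length w. j * w ! j" arbitrary: w rule: less_induct)
  case less
  show ?case
  proof (cases "\<exists>p. violation m w p")
    case True
    then obtain w' where w': "swapped w w'" "root_word m w'"
      "(\<Sum>j<length w'. j * w' ! j) < (\<Sum>j<length w. j * w ! j)"
      using violation_improvable[OF less.prems(1,2) _ less.prems(3)] by blast
    have ms: "mset w' = mset w" "set w' = set w"
      using mset_swapped[OF w'(1)] mset_eq_setD by blast+
    obtain w'' where "(word_step m)\<^sup>*\<^sup>* w' w''" "root_word m w''" "\<forall>p. \<not> violation m w'' p"
      using less.hyps[OF w'(3,2) less.prems(2)] less.prems(3) unfolding ms by blast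
    moreover have "word_step m w w'" using w' less.prems(1) unfolding word_step_def by blast
    ultimately show ?thesis by (meson converse_rtranclp_into_rtranclp)
  next
    case False
    then show ?thesis using less.prems(1) by blast
  qed
qed

lemma word_steps_connected:
  assumes "root_word m w" and "root_word m w'" and "mset w = mset w'" and "m > 0"
    and rep: "multiples_repeated m (mset w)"
  shows "(word_step m)\<^sup>*\<^sup>* w w'"
proof -
  obtain u where u: "(word_step m)\<^sup>*\<^sup>* w u" "root_word m u" "\<forall>p. \<not> violation m u p"
    using reaches_violation_free[OF assms(1,4) rep] by blast
  have "set w' = set w" using assms(3) mset_eq_setD by metis
  then obtain u' where u': "(word_step m)\<^sup>*\<^sup>* w' u'" "root_word m u'" "\<forall>p. \<not> violation m u' p"
    using reaches_violation_free[OF assms(2,4)] rep assms(3) by auto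
  have "u = u'"
    using violation_free_unique u u' assms(3) mset_word_steps by metis
  then show ?thesis using u(1) word_steps_sym[OF u'(1)] by simp
qed

section \<open>Multiples that occur once and words that no swaps connect\<close>

text \<open>As \<open>w\<close> takes \<open>s\<close> only at \<open>b\<close>, the entry
  \<open>w ! a\<close> is below \<open>s\<close>, and \<open>y\<close> comes after \<open>b\<close>.
  In \<open>w'\<close> the entry at \<open>b\<close> is then below \<open>s\<close>, so
  \<open>w'\<close> must meet \<open>s\<close> again on its way to \<open>y\<close>, although its
  only \<open>s\<close> is at \<open>a\<close>.\<close>

lemma unique_multiple_not_moved_left:
  assumes w: "root_word m w" and w': "root_word m w'" and m: "m > 0" and s: "m dvd s"
    and len: "length w' = length w" and ab: "a < b" "b < length w"
    and eq: "w ! b = s" "w' ! a = s" "w' ! b = w ! a" "w ! a \<noteq> s"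
    and rest: "\<And>q. q \<noteq> a \<Longrightarrow> q \<noteq> b \<Longrightarrow> w' ! q = w ! q"
    and once: "count (mset w) s \<le> 1" "count (mset w') s \<le> 1"
    and y: "y \<in> set w" "s < y"
  shows False
proof -
  have uniq: "q = b" if "q < length w" "w ! q = s" for q
    using count_le_1_unique[OF once(1) that(1) ab(2) that(2) eq(1)] .
  have uniq': "q = a" if "q < length w" "w' ! q = s" for q
    using count_le_1_unique[OF once(2) _ _ that(2) eq(2)] that(1) ab len by simp
  obtain c where c: "c < length w" "w ! c = y" using y(1) by (auto simp: in_set_conv_nth)
  obtain d where "d \<le> c" "w ! d = s"
    using root_word_passes[OF w m c(1), of s] c(2) y(2) s by auto
  then have bc: "b < c" using uniq[of d] c y(2) eq(1) by (metis le_less_trans le_neq_implies_less less_irrefl)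
  have "w ! a < s"
  proof (rule ccontr)
    assume "\<not> w ! a < s"
    then obtain d where "d \<le> a" "w ! d = s"
      using root_word_passes[OF w m _ _ s, of a] ab by auto
    then show False using uniq[of d] ab by simp
  qed
  moreover have "w' ! c = y" using rest bc c(2) ab by auto
  ultimately obtain d where "b < d" "d \<le> c" "w' ! d = s"
    using root_word_crossing[OF w' m, of b c s] bc c(1) len eq(3) y(2) s by auto
  then show False using uniq'[of d] c(1) ab by simp
qed

lemma unique_multiple_fixed_by_step:
  assumes step: "word_step m w w'" and m: "m > 0" and s: "m dvd s"
    and once: "count (mset w) s \<le> 1" and y: "y \<in> set w" "s < y"
    and p: "p < length w" "w ! p = s"
  shows "w' ! p = s"
proof (rule ccontr)
  assume np: "w' ! p \<noteq> s"
  obtain a b where ab: "a < b" "b < length w" "w ! a \<noteq> w ! b" "w' = w[a := w ! b, b := w ! a]"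
    using step unfolding word_step_def swapped_def by blast
  have w: "root_word m w" and w': "root_word m w'" and sw: "swapped w w'"
    using step unfolding word_step_def by auto
  have once': "count (mset w') s \<le> 1" and y': "y \<in> set w'"
    using mset_swapped[OF sw] once y(1) mset_eq_setD[OF mset_swapped[OF sw]] by auto
  have nth: "w' ! a = w ! b" "w' ! b = w ! a" "\<And>q. q \<noteq> a \<Longrightarrow> q \<noteq> b \<Longrightarrow> w' ! q = w ! q"
    "length w' = length w"
    using ab by auto
  have "p = a \<or> p = b" using nth(3)[of p] np p(2) by blast
  then show False
  proof
    \<comment> \<open>Here \<open>s\<close> moves right, so the inverse swap moves it left and the
      two words exchange roles.\<close>
    assume "p = a"
    then show False
      by (intro unique_multiple_not_moved_left[OF w' w m s, where a = a and b = b and y = y])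
         (use nth(1,2,4) nth(3)[symmetric] ab(1-3) p once once' y' y(2) in simp_all)
  next
    assume "p = b"
    then show False
      by (intro unique_multiple_not_moved_left[OF w w' m s, where a = a and b = b and y = y])
         (use nth ab(1-3) p once once' y in simp_all)
  qed
qed

lemma unique_multiple_fixed_by_steps:
  assumes "(word_step m)\<^sup>*\<^sup>* w w'" and "m > 0" and "m dvd s"
    and "count (mset w) s \<le> 1" and "y \<in> set w" "s < y" and "p < length w" "w ! p = s"
  shows "w' ! p = s"
  using assms(1)
proof (induction rule: rtranclp_induct)
  case base
  then show ?case using assms by simp
next
  case (step u v)
  have ms: "mset u = mset w" using mset_word_steps[OF step.hyps(1)] .
  then have "set u = set w" "length u = length w" using mset_eq_setD mset_eq_length by blast+
  then show ?case
    using unique_multiple_fixed_by_step[OF step.hyps(2) assms(2,3), of y p] ms assms step.IH by simp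
qed

text \<open>If a sorted entry exceeded the cap of its predecessor, that cap would be a multiple of
  \<open>m\<close> below an entry of \<open>w\<close>, hence itself an entry, and sorting would
  place it between the two.\<close>

lemma root_word_sort:
  assumes w: "root_word m w" and m: "m > 0"
  shows "root_word m (sort w)"
proof -
  let ?t = "sort w"
  have ne: "w \<noteq> []" and z: "w ! 0 = 0" using w unfolding root_word_def by auto
  have "0 \<in> set w" using ne z by (metis length_greater_0_conv nth_mem)
  then obtain k where "k < length ?t" "?t ! k = 0" by (metis in_set_conv_nth set_sort)
  then have "?t ! 0 = 0" using sorted_nth_mono[of ?t 0 k] by simp
  moreover have "?t ! Suc p \<le> m * (?t ! p div m + 1)" if p: "Suc p < length ?t" for p
  proof (rule ccontr)
    let ?c = "m * (?t ! p div m + 1)"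
    assume "\<not> ?t ! Suc p \<le> ?c"
    then have gt: "?c < ?t ! Suc p" by simp
    have "?t ! Suc p \<in> set w" using p by (metis nth_mem set_sort)
    then obtain j where "j < length w" "w ! j = ?t ! Suc p" by (auto simp: in_set_conv_nth)
    then obtain d where "d \<le> j" "w ! d = ?c"
      using root_word_passes[OF w m, of j ?c] gt by auto
    then have "?c \<in> set w" using \<open>j < length w\<close> by (metis le_less_trans nth_mem)
    then have "?c \<in> set ?t" by (simp only: set_sort)
    then obtain k where k: "k < length ?t" "?t ! k = ?c" unfolding in_set_conv_nth by blast
    have "?t ! p < ?c" using dividend_less_times_div[OF m, of "?t ! p"] by simp
    then have "p < k" using sorted_nth_mono[of ?t k p] k p by (metis Suc_lessD leD leI sorted_sort)
    then have "?t ! Suc p \<le> ?t ! k" using sorted_nth_mono[of ?t "Suc p" k] k by simp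
    then show False using gt k by simp
  qed
  ultimately show ?thesis using ne unfolding root_word_def by (metis set_empty set_sort)
qed

text \<open>The word consists of the multiples of \<open>m\<close> from 0 up to
  \<open>m * K\<close>, the largest one not above the maximum, followed by the remaining entries in
  weakly decreasing order. All these multiples are available because \<open>w\<close> passes through
  them.\<close>

lemma root_word_multiples_first:
  assumes w: "root_word m w" and m: "m > 0"
  shows "\<exists>u. root_word m u \<and> mset u = mset w \<and> (\<forall>q. m * q \<le> Max (set w) \<longrightarrow> u ! q = m * q)"
proof -
  define K where "K = Max (set w) div m"
  have ne: "w \<noteq> []" using w unfolding root_word_def by auto
  have le_K: "q \<le> K \<longleftrightarrow> m * q \<le> Max (set w)" for q
    unfolding K_def using m by (simp add: less_eq_div_iff_mult_less_eq mult.commute)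
  let ?b = "map ((*) m) [0..<Suc K]"
  have "set ?b \<subseteq> set w"
  proof
    fix x assume "x \<in> set ?b"
    then obtain q where q: "x = m * q" "q \<le> K" unfolding set_map by force
    obtain c where "c < length w" "w ! c = Max (set w)"
      using Max_in[of "set w"] ne by (metis List.finite_set in_set_conv_nth set_empty)
    then show "x \<in> set w"
      using root_word_passes[OF w m, of c x] q le_K[of q] by (metis dvd_triv_left le_less_trans nth_mem)
  qed
  moreover have "distinct ?b" unfolding distinct_map using m by (simp add: inj_on_def del: upt_Suc)
  ultimately have sub: "mset ?b \<subseteq># mset w"
    by (intro mset_subset_eqI)
       (simp add: distinct_count_atmost_1 count_greater_eq_one_iff subset_iff del: upt_Suc)
  obtain r where r: "mset r = mset w - mset ?b" using ex_mset by blast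
  let ?u = "?b @ rev (sort r)"
  have ms: "mset ?u = mset w" using r subset_mset.add_diff_inverse[OF sub] by (simp only: mset_append mset_rev mset_sort)
  have len: "length ?b = Suc K" by simp
  have step: "y \<le> m * (x div m + 1)" if "y \<le> x" for x y
    using that dividend_less_times_div[OF m, of x] by simp
  have "successively (\<lambda>x y. y \<le> m * (x div m + 1)) ?u"
    unfolding successively_append_iff
  proof (intro conjI)
    show "successively (\<lambda>x y. y \<le> m * (x div m + 1)) ?b"
      unfolding successively_conv_nth using m by (auto simp del: upt_Suc)
    have "successively (\<le>) (sort r)"
      unfolding successively_conv_nth using sorted_sort[of r] by (simp only: sorted_iff_nth_Suc)
    then show "successively (\<lambda>x y. y \<le> m * (x div m + 1)) (rev (sort r))"
      unfolding successively_rev by (rule successively_mono) (use step in blast)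
    \<comment> \<open>The junction is where the choice of \<open>K\<close> matters: the cap of the
      last multiple bounds every entry.\<close>
    show "?b = [] \<or> rev (sort r) = [] \<or> hd (rev (sort r)) \<le> m * (last ?b div m + 1)"
    proof (cases "r = []")
      case False
      then have "hd (rev (sort r)) \<in> set r" by (metis hd_in_set rev_is_Nil_conv set_rev set_sort set_empty)
      then have "hd (rev (sort r)) \<in> set w" using r by (metis in_diffD set_mset_mset)
      then have "hd (rev (sort r)) \<le> Max (set w)" by simp
      also have "\<dots> \<le> m * (K + 1)" unfolding K_def
        using dividend_less_times_div[OF m, of "Max (set w)"] by simp
      finally show ?thesis using m by simp
    qed simp
  qed
  moreover have nth: "?u ! q = m * q" if "m * q \<le> Max (set w)" for q
    using that le_K[of q] len by (simp add: nth_append del: upt_Suc)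
  ultimately have "root_word m ?u"
    unfolding root_word_def successively_conv_nth using nth[of 0] by auto
  then show ?thesis using ms nth by blast
qed

text \<open>Steps fix the position of \<open>s\<close>, so two arrangements with \<open>s\<close> at
  different indices are not connected. The sorted word and the word with the multiples in front are
  such a pair.\<close>

lemma unique_multiple_moves:
  assumes w: "root_word m w" and m: "m > 0" and s: "m dvd s"
    and once: "count (mset w) s \<le> 1" and y: "y \<in> set w" "s < y"
    and e: "e \<in> set w" "e < s" "2 \<le> count (mset w) e \<or> \<not> m dvd e"
  shows "\<exists>u v. root_word m u \<and> mset u = mset w \<and> root_word m v \<and> mset v = mset w \<and> \<not> (word_step m)\<^sup>*\<^sup>* u v"
proof -
  obtain u where u: "root_word m u" "mset u = mset w" "\<And>q. m * q \<le> Max (set w) \<Longrightarrow> u ! q = m * q"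
    using root_word_multiples_first[OF w m] by blast
  have su: "set u = set w" "length u = length w" using u(2) mset_eq_setD mset_eq_length by blast+
  obtain q where q: "s = m * q" using s by blast
  have max: "s \<le> Max (set w)" using y by (meson List.finite_set Max_ge le_trans less_imp_le)
  let ?t = "sort w"
  have t: "root_word m ?t" "mset ?t = mset w" using root_word_sort[OF w m] by auto
  obtain c where c: "c < length ?t" "?t ! c = y" using y(1) by (metis in_set_conv_nth set_sort)
  obtain p where p: "p < length ?t" "?t ! p = s"
    using root_word_passes[OF t(1) m c(1), of s] c y s by (metis le_less_trans less_imp_le)
  have before: "x \<in> set (take p ?t)" if "x \<in> set w" "x < s" for x
  proof -
    have "x \<in> set ?t" using that(1) by simp
    then obtain k where k: "k < length ?t" "?t ! k = x" unfolding in_set_conv_nth by blast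
    then have "k < p" using sorted_nth_mono[of ?t p k] p that(2) by (cases "p \<le> k") auto
    then have "k < length (take p ?t)" "take p ?t ! k = x" using k by auto
    then show ?thesis using nth_mem by blast
  qed
  \<comment> \<open>\<open>s\<close> stands at index \<open>s div m\<close> in \<open>u\<close>, but \<open>e\<close> pushes it further right in the sorted word.\<close>
  have "\<not> (word_step m)\<^sup>*\<^sup>* ?t u"
  proof
    assume "(word_step m)\<^sup>*\<^sup>* ?t u"
    then have up: "u ! p = s"
      using unique_multiple_fixed_by_steps[OF _ m s _ _ y(2) p] once y(1) t(2) by (metis set_sort)
    have plen: "p < length u" using p su by simp
    have "u ! q = s" using u(3)[of q] max q by simp
    \<comment> \<open>The description of \<open>u\<close> does not state that \<open>q\<close> is in
      range. Otherwise \<open>p\<close> would be smaller than \<open>q\<close>, and there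
      \<open>u\<close> holds \<open>m * p\<close> rather than \<open>s\<close>.\<close>
    moreover have "q < length u"
    proof (rule ccontr)
      assume "\<not> q < length u"
      then have "p < q" using plen by simp
      then have "m * p < s" using q m by simp
      then have "u ! p = m * p" using u(3)[of p] max by simp
      then show False using up \<open>m * p < s\<close> by simp
    qed
    ultimately have "p = q"
      using count_le_1_unique[of u s p q] once u(2) up plen by simp
    \<comment> \<open>All \<open>q\<close> multiples below \<open>s\<close> precede \<open>s\<close>
      in the sorted word, where exactly \<open>p = q\<close> entries do. So these entries are the
      multiples, once each, which leaves no room for \<open>e\<close>.\<close>
    let ?A = "(*) m ` {..<q}"
    have A: "?A \<subseteq> set (take p ?t)"
    proof
      fix x assume "x \<in> ?A"
      then obtain k where k: "x = m * k" "k < q" by auto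
      then have "x < s" using q m by simp
      then have "u ! k = x" using u(3)[of k] k max by simp
      then have "x \<in> set w" using k(2) \<open>q < length u\<close> su(1) by (metis less_trans nth_mem)
      then show "x \<in> set (take p ?t)" using before \<open>x < s\<close> by blast
    qed
    have cA: "card ?A = p" using m \<open>p = q\<close> by (subst card_image) (auto simp: inj_on_def)
    have lt: "length (take p ?t) = p" using p by simp
    have "card (set (take p ?t)) \<le> p" using card_length[of "take p ?t"] lt by simp
    then have eqA: "?A = set (take p ?t)" using A cA by (intro card_seteq) auto
    then have dist: "distinct (take p ?t)" using cA lt by (metis card_distinct)
    have "m dvd e" using before[OF e(1,2)] unfolding eqA[symmetric] by auto
    then have "2 \<le> count (mset ?t) e" using e(3) t(2) by simp
    then obtain a b where ab: "a < b" "b < length ?t" "?t ! a = e" "?t ! b = e"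
      unfolding count_ge_2_iff by blast
    then have "b < p" using sorted_nth_mono[of ?t p b] p e(2) by (cases "p \<le> b") auto
    then show False using nth_eq_iff_index_eq[OF dist, of a b] ab lt by simp
  qed
  then show ?thesis using t u by blast
qed

section \<open>Rook numbers of singleton boards and root multisets\<close>

lemma finite_cells: "finite (cells B)"
proof -
  have "cells B = (SIGMA c:{..<length B}. {1..B ! c})" unfolding cells_def by auto
  then show ?thesis by simp
qed

lemma cells_snoc: "cells (B @ [b]) = cells B \<union> Pair (length B) ` {1..b}"
  unfolding cells_def by (auto simp: nth_append less_Suc_eq)

lemma level_eq_iff:
  assumes "m > 0" "r \<ge> 1"
  shows "level m r = t \<longleftrightarrow> r \<in> {m * t + 1..m * t + m}"
proof -
  obtain q where r: "r = Suc q" using assms(2) by (cases r) auto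
  have "q div m = t \<longleftrightarrow> m * t \<le> q \<and> q < m * t + m"
    using div_nat_eqI[of m t q] times_div_less_eq_dividend[of m q]
      dividend_less_times_div[OF assms(1), of q] by auto
  then show ?thesis unfolding level_def r by auto
qed

text \<open>If the height of column \<open>c\<close> is a multiple of \<open>m\<close>, its levels
  are complete in it and the last column is no lower. Otherwise the singleton condition makes the
  next column, possibly the new one, complete the partial top level. Hence each earlier rook blocks
  exactly \<open>m\<close> cells of the new column.\<close>

lemma level_covered_by_next_column:
  assumes "m > 0" "ferrers (B @ [b])" "singleton_board m (B @ [b])" "(c, r) \<in> cells B"
  shows "m * level m r + m \<le> b"
proof -
  have c: "c < length B" "1 \<le> r" "r \<le> B ! c" using assms(4) unfolding cells_def by auto
  let ?B = "B @ [b]" and ?d = "B ! c"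
  have last: "?B ! i \<le> b" if "i < length ?B" for i
    using sorted_nth_mono[of ?B i "length B"] assms(2) that unfolding ferrers_def by simp
  have lev: "level m r \<le> (?d - 1) div m" unfolding level_def using c by (intro div_le_mono) simp
  show ?thesis
  proof (cases "m dvd ?d")
    case True
    then obtain t where t: "?d = m * t" by (rule dvdE)
    have "level m r < t" unfolding level_def using c t assms(1)
      by (simp add: div_less_iff_less_mult mult.commute)
    then have "m * (level m r + 1) \<le> ?d" unfolding t by (intro mult_le_mono2) simp
    then show ?thesis using last[of c] c(1) by (simp add: nth_append)
  next
    case False
    then have "?d - floor_m m ?d \<noteq> 0"
      unfolding floor_m_def by (metis diff_is_0_eq dvd_triv_left le_antisym times_div_less_eq_dividend)
    then have "floor_m m ?d < floor_m m (?B ! (c + 1))"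
      using assms(3) c(1) unfolding singleton_board_def by (auto simp: nth_append dest!: spec[of _ c])
    then have "?d div m < ?B ! (c + 1) div m" unfolding floor_m_def by simp
    then have "level m r + 1 \<le> ?B ! (c + 1) div m"
      using lev div_le_mono[of "?d - 1" ?d m] by simp
    then have "m * (level m r + 1) \<le> ?B ! (c + 1)"
      using assms(1) by (simp add: less_eq_div_iff_mult_less_eq mult.commute)
    then show ?thesis using last[of "c + 1"] c(1) by simp
  qed
qed

definition placements :: "nat \<Rightarrow> nat \<Rightarrow> nat list \<Rightarrow> (nat \<times> nat) set set" where
  "placements m k B = {P. P \<subseteq> cells B \<and> card P = k \<and> inj_on fst P \<and> inj_on (\<lambda>(c, r). level m r) P}"

lemma rook_num_eq: "rook_num m k B = card (placements m k B)"
  unfolding rook_num_def placements_def ..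

lemma finite_placements: "finite (placements m k B)"
  unfolding placements_def by (rule finite_subset[OF _ finite_Pow_iff[THEN iffD2, OF finite_cells[of B]]]) auto

lemma placement_finite: "P \<in> placements m k B \<Longrightarrow> finite P"
  unfolding placements_def using finite_subset[OF _ finite_cells] by auto

lemma rook_num_0: "rook_num m 0 B = 1"
proof -
  have "P = {}" if "P \<in> placements m 0 B" for P
    using placement_finite[OF that] that unfolding placements_def by simp
  moreover have "{} \<in> placements m 0 B" unfolding placements_def by simp
  ultimately have "placements m 0 B = {{}}" by blast
  then show ?thesis unfolding rook_num_eq by simp
qed

lemma rook_num_eq_0:
  assumes "length B < k"
  shows "rook_num m k B = 0"
proof -
  have "card P \<le> length B" if "P \<subseteq> cells B" "inj_on fst P" for P
  proof -
    have "card P = card (fst ` P)" using that(2) by (simp add: card_image)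
    also have "\<dots> \<le> card {..<length B}"
      by (rule card_mono) (use that(1) in \<open>auto simp: cells_def\<close>)
    finally show ?thesis by simp
  qed
  then have "P \<notin> placements m k B" for P
    unfolding placements_def using assms by (metis (mono_tags, lifting) mem_Collect_eq not_le)
  then have "placements m k B = {}" by blast
  then show ?thesis unfolding rook_num_eq by simp
qed

text \<open>The \<open>k\<close> rooks occupy distinct levels, and each of these lies entirely
  inside the new column, so the blocked rows form disjoint blocks of size \<open>m\<close>.\<close>

lemma card_free_rows:
  assumes "m > 0" "ferrers (B @ [b])" "singleton_board m (B @ [b])" "Q \<in> placements m k B"
  shows "m * k \<le> b"
    and "card {r \<in> {1..b}. level m r \<notin> (\<lambda>(c, r). level m r) ` Q} = b - m * k"
proof -
  let ?T = "(\<lambda>(c, r). level m r) ` Q"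
  let ?U = "\<Union>t\<in>?T. {m * t + 1..m * t + m}"
  have Q: "Q \<subseteq> cells B" "card Q = k" "inj_on (\<lambda>(c, r). level m r) Q"
    using assms(4) unfolding placements_def by auto
  have fin: "finite ?T" using placement_finite[OF assms(4)] by simp
  have disj: "{m * s + 1..m * s + m} \<inter> {m * t + 1..m * t + m} = {}" if "s \<noteq> t" for s t
  proof (rule ccontr)
    assume "{m * s + 1..m * s + m} \<inter> {m * t + 1..m * t + m} \<noteq> {}"
    then obtain r where "r \<in> {m * s + 1..m * s + m}" "r \<in> {m * t + 1..m * t + m}" by blast
    then show False using level_eq_iff[OF assms(1), of r] that by (metis atLeastAtMost_iff le_add2 le_trans)
  qed
  have "card ?U = (\<Sum>t\<in>?T. card {m * t + 1..m * t + m})"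
    using disj by (intro card_UN_disjoint fin) auto
  also have "\<dots> = m * k" using Q(2,3) by (simp add: card_image)
  finally have cU: "card ?U = m * k" .
  have sub: "?U \<subseteq> {1..b}"
  proof
    fix r assume "r \<in> ?U"
    then obtain t where t: "t \<in> ?T" "r \<in> {m * t + 1..m * t + m}" by blast
    from t(1) obtain x where x: "x \<in> Q" "t = (\<lambda>(c, r). level m r) x" by blast
    obtain c r' where c: "x = (c, r')" by (cases x)
    have "m * t + m \<le> b"
      using level_covered_by_next_column[OF assms(1-3), of c r'] c x Q(1) by auto
    then show "r \<in> {1..b}" using t(2) by simp
  qed
  show "m * k \<le> b" using card_mono[OF _ sub] cU by simp
  have "r \<in> ?U \<longleftrightarrow> level m r \<in> ?T" if "r \<in> {1..b}" for r
    using level_eq_iff[OF assms(1), of r] that by (simp only: UN_iff atLeastAtMost_iff) metis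
  then have "{r \<in> {1..b}. level m r \<notin> ?T} = {1..b} - ?U" by blast
  then show "card {r \<in> {1..b}. level m r \<notin> ?T} = b - m * k"
    using card_Diff_subset[OF _ sub] cU finite_subset[OF sub] by simp
qed

lemma placements_snoc:
  "placements m (Suc k) (B @ [b]) = placements m (Suc k) B \<union>
     (\<lambda>(Q, r). insert (length B, r) Q) `
       (SIGMA Q:placements m k B. {r \<in> {1..b}. level m r \<notin> (\<lambda>(c, r). level m r) ` Q})"
  (is "?L = _ \<union> ?R")
proof (intro equalityI subsetI)
  let ?n = "length B"
  fix P assume P: "P \<in> ?L"
  have fin: "finite P" using placement_finite[OF P] .
  have P': "P \<subseteq> cells B \<union> Pair ?n ` {1..b}" "card P = Suc k" "inj_on fst P" "inj_on (\<lambda>(c, r). level m r) P"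
    using P unfolding placements_def cells_snoc by auto
  show "P \<in> placements m (Suc k) B \<union> ?R"
  proof (cases "P \<subseteq> cells B")
    case True
    then show ?thesis using P' unfolding placements_def by blast
  next
    case False
    then obtain r where r: "(?n, r) \<in> P" "r \<in> {1..b}" using P'(1) by blast
    let ?Q = "P - {(?n, r)}"
    have "fst x \<noteq> ?n" if "x \<in> ?Q" for x
      using P'(3) r(1) that by (metis Diff_iff fst_conv inj_on_def singletonI)
    then have "?Q \<subseteq> cells B" using P'(1) by fastforce
    then have "?Q \<in> placements m k B"
      using P' r(1) fin unfolding placements_def by (auto intro: inj_on_subset)
    moreover have "level m r \<notin> (\<lambda>(c, r). level m r) ` ?Q"
    proof
      assume "level m r \<in> (\<lambda>(c, r). level m r) ` ?Q"
      then obtain x where "x \<in> ?Q" "level m r = (\<lambda>(c, r). level m r) x" by blast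
      then show False using inj_onD[OF P'(4), of "(?n, r)" x] r(1) by simp
    qed
    moreover have "P = insert (?n, r) ?Q" using r(1) by blast
    ultimately have "P \<in> ?R"
      using r(2) by (intro image_eqI[of _ _ "(?Q, r)"] SigmaI) (simp_all only: case_prod_conv mem_Collect_eq simp_thms)
    then show ?thesis by blast
  qed
next
  let ?n = "length B"
  have notin: "(?n, r) \<notin> cells B" for r unfolding cells_def by simp
  fix P assume "P \<in> placements m (Suc k) B \<union> ?R"
  then show "P \<in> ?L"
  proof
    assume "P \<in> placements m (Suc k) B"
    then show ?thesis unfolding placements_def cells_snoc by blast
  next
    assume "P \<in> ?R"
    then obtain Q r where Q: "Q \<in> placements m k B" "r \<in> {1..b}" "level m r \<notin> (\<lambda>(c, r). level m r) ` Q"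
      and P: "P = insert (?n, r) Q" by auto
    have fin: "finite Q" using placement_finite[OF Q(1)] .
    have Q': "Q \<subseteq> cells B" "card Q = k" "inj_on fst Q" "inj_on (\<lambda>(c, r). level m r) Q"
      using Q(1) unfolding placements_def by auto
    have "(?n, r) \<notin> Q" using Q'(1) notin by blast
    moreover have "?n \<notin> fst ` Q" using Q'(1) unfolding cells_def by auto
    ultimately have "inj_on fst P" "inj_on (\<lambda>(c, r). level m r) P" "card P = Suc k"
      unfolding P using Q'(2-4) Q(3) fin by (simp_all add: inj_on_insert)
    then show ?thesis
      using Q'(1) Q(2) unfolding P placements_def cells_snoc by auto
  qed
qed

lemma rook_num_snoc:
  assumes "m > 0" "ferrers (B @ [b])" "singleton_board m (B @ [b])"
  shows "int (rook_num m (Suc k) (B @ [b])) =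
           int (rook_num m (Suc k) B) + (int b - int (m * k)) * int (rook_num m k B)"
proof -
  let ?n = "length B"
  let ?free = "\<lambda>Q. {r \<in> {1..b}. level m r \<notin> (\<lambda>(c, r). level m r) ` Q}"
  let ?S = "SIGMA Q:placements m k B. ?free Q"
  let ?f = "\<lambda>(Q, r). insert (length B, r) Q"
  have notin: "(?n, r) \<notin> Q" if "Q \<in> placements m j B" for Q r j
    using that unfolding placements_def cells_def by auto
  have fin: "finite ?S" by (intro finite_SigmaI finite_placements) simp
  have inj: "inj_on ?f ?S"
  proof (rule inj_onI, clarify)
    fix Q r Q' r'
    assume Q: "Q \<in> placements m k B" "Q' \<in> placements m k B" "insert (?n, r) Q = insert (?n, r') Q'"
    have "r = r'" using notin[OF Q(2), of r] Q(3) by auto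
    then have "Q = Q'" using insert_ident[OF notin[OF Q(1)] notin[OF Q(2)]] Q(3) by simp
    then show "Q = Q' \<and> r = r'" using \<open>r = r'\<close> by simp
  qed
  have "insert (?n, r) Q \<notin> placements m (Suc k) B" for r Q using notin by blast
  then have "placements m (Suc k) B \<inter> ?f ` ?S = {}" by auto
  then have "rook_num m (Suc k) (B @ [b]) = rook_num m (Suc k) B + card (?f ` ?S)"
    unfolding rook_num_eq placements_snoc using fin by (intro card_Un_disjoint finite_placements) auto
  also have "card (?f ` ?S) = card ?S" using inj by (rule card_image)
  also have "card ?S = (\<Sum>Q\<in>placements m k B. card (?free Q))"
    by (intro card_SigmaI finite_placements) simp
  finally have "int (rook_num m (Suc k) (B @ [b])) =
    int (rook_num m (Suc k) B) + (\<Sum>Q\<in>placements m k B. int (card (?free Q)))" by simp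
  \<comment> \<open>Any placement in the index set certifies \<open>m * k \<le> b\<close>, so the
    truncated difference is the integer one; for smaller \<open>b\<close> the sum is empty.\<close>
  also have "(\<Sum>Q\<in>placements m k B. int (card (?free Q))) = (\<Sum>Q\<in>placements m k B. int b - int (m * k))"
    using card_free_rows[OF assms] by (intro sum.cong) (auto simp: of_nat_diff)
  finally show ?thesis unfolding rook_num_eq by (simp add: mult.commute)
qed

section \<open>The factorization theorem and rook equivalence through root multisets\<close>

lemma sorted_singleton_butlast:
  assumes "ferrers (B @ [b])" "singleton_board m (B @ [b])"
  shows "ferrers B" "singleton_board m B"
proof -
  show "ferrers B" using assms(1) unfolding ferrers_def by (simp add: sorted_append)
  show "singleton_board m B" unfolding singleton_board_def
  proof (intro allI impI)
    fix i assume "i + 1 < length B" "B ! i - floor_m m (B ! i) \<noteq> 0"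
    then show "floor_m m (B ! i) < floor_m m (B ! (i + 1))"
      using assms(2)[unfolded singleton_board_def, rule_format, of i] by (simp add: nth_append)
  qed
qed

text \<open>The falling factorial of length \<open>j\<close> with step \<open>m\<close>.\<close>

definition falling :: "nat \<Rightarrow> int \<Rightarrow> nat \<Rightarrow> int" where
  "falling m x j = (\<Prod>i<j. x - int (m * i))"

lemma root_vec_snoc: "root_vec m (B @ [b]) = root_vec m B @ [int (m * length B) - int b]"
  unfolding root_vec_def by (auto simp: nth_append)

text \<open>With \<open>n\<close> columns present, the new linear factor splits for each
  \<open>k\<close> as \<open>x - m * (n - k)\<close> plus \<open>b - m * k\<close>. The first part
  lengthens the falling factorial, and the second counts the free rows of the new column, which
  matches the recurrence for the rook numbers.\<close>

lemma rook_factorization: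
  assumes "m > 0" "ferrers B" "singleton_board m B"
  shows "(\<Prod>z\<leftarrow>root_vec m B. x - z) =
           (\<Sum>k\<le>length B. int (rook_num m k B) * falling m x (length B - k))"
  using assms(2,3)
proof (induction B rule: rev_induct)
  case Nil
  then show ?case by (simp add: root_vec_def falling_def rook_num_0)
next
  case (snoc b B)
  let ?n = "length B" and ?r = "\<lambda>k. int (rook_num m k B)" and ?f = "falling m x"
  note IH = snoc.IH[OF sorted_singleton_butlast[OF snoc.prems]]
  have fS: "?f (Suc j) = (x - int (m * j)) * ?f j" for j by (simp add: falling_def)
  have *: "(x - (int (m * ?n) - int b)) * (?r k * ?f (?n - k)) =
     ?r k * ?f (Suc ?n - k) + (int b - int (m * k)) * ?r k * ?f (?n - k)" if "k \<le> ?n" for k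
  proof -
    have "int (m * (?n - k)) = int (m * ?n) - int (m * k)"
      using that by (simp add: right_diff_distrib of_nat_diff)
    then have fSS: "?f (Suc ?n - k) = (x - (int (m * ?n) - int (m * k))) * ?f (?n - k)"
      using that fS[of "?n - k"] by (simp add: Suc_diff_le del: of_nat_mult)
    show ?thesis unfolding fSS by (simp add: algebra_simps)
  qed
  have "(\<Prod>z\<leftarrow>root_vec m (B @ [b]). x - z) =
    (x - (int (m * ?n) - int b)) * (\<Sum>k\<le>?n. ?r k * ?f (?n - k))"
    by (simp add: root_vec_snoc IH mult.commute)
  also have "\<dots> = (\<Sum>k\<le>?n. ?r k * ?f (Suc ?n - k)) + (\<Sum>k\<le>?n. (int b - int (m * k)) * ?r k * ?f (?n - k))"
    unfolding sum_distrib_left sum.distrib[symmetric] using * by (intro sum.cong) auto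
  \<comment> \<open>The added term vanishes since \<open>B\<close> has fewer than
    \<open>Suc ?n\<close> columns; then the term for \<open>k = 0\<close> splits off and the index
    shifts.\<close>
  also have "(\<Sum>k\<le>?n. ?r k * ?f (Suc ?n - k)) = (\<Sum>k\<le>Suc ?n. ?r k * ?f (Suc ?n - k))"
    by (simp add: rook_num_eq_0)
  also have "\<dots> = ?f (Suc ?n) + (\<Sum>k\<le>?n. ?r (Suc k) * ?f (?n - k))"
    by (simp add: sum.atMost_Suc_shift rook_num_0 del: sum.atMost_Suc)
  also have "\<dots> + (\<Sum>k\<le>?n. (int b - int (m * k)) * ?r k * ?f (?n - k)) =
    ?f (Suc ?n) + (\<Sum>k\<le>?n. int (rook_num m (Suc k) (B @ [b])) * ?f (?n - k))"
    by (simp add: rook_num_snoc[OF assms(1) snoc.prems] sum.distrib[symmetric] algebra_simps)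
  also have "\<dots> = (\<Sum>k\<le>Suc ?n. int (rook_num m k (B @ [b])) * ?f (Suc ?n - k))"
    by (simp add: sum.atMost_Suc_shift rook_num_0 del: sum.atMost_Suc)
  finally show ?case by simp
qed

text \<open>The system is triangular: at \<open>x = m * j\<close> all falling factorials longer than
  \<open>j\<close> vanish, and the coefficients of the shorter ones agree by induction.\<close>

lemma falling_coeffs_unique:
  assumes m: "m > 0"
    and eq: "\<And>x. (\<Sum>k\<le>n. c k * falling m x (n - k)) = (\<Sum>k\<le>n. d k * falling m x (n - k))"
    and k: "k \<le> n"
  shows "c k = d k"
proof -
  have "c (n - j) = d (n - j)" if "j \<le> n" for j
    using that
  proof (induction j rule: less_induct)
    case (less j)
    let ?x = "int (m * j)" and ?e = "\<lambda>k. c k - d k"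
    have "(\<Sum>k\<le>n. ?e k * falling m ?x (n - k)) = 0"
      using eq[of ?x] by (simp add: left_diff_distrib sum_subtractf)
    moreover have "?e k * falling m ?x (n - k) = 0" if "k \<in> {..n} - {n - j}" for k
    proof (cases "n - k < j")
      case True
      then have "c (n - (n - k)) = d (n - (n - k))" using less by auto
      then show ?thesis using that by simp
    next
      case False
      then have "j < n - k" using that less.prems by auto
      then have "falling m ?x (n - k) = 0" unfolding falling_def by (intro prod_zero) auto
      then show ?thesis by simp
    qed
    then have "(\<Sum>k\<in>{..n} - {n - j}. ?e k * falling m ?x (n - k)) = 0" by (intro sum.neutral) blast
    ultimately have "?e (n - j) * falling m ?x (n - (n - j)) = 0"
      by (simp add: sum.remove[of "{..n}" "n - j"])
    moreover have "falling m ?x j \<noteq> 0" unfolding falling_def using m by (simp add: prod_zero_iff)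
    ultimately show ?case using less.prems by simp
  qed
  from this[of "n - k"] show ?thesis using k by simp
qed

lemma proots_prod_linear: "proots (\<Prod>z\<in>#A. [:- z, 1 :: 'a :: idom:]) = A"
proof (induction A)
  case (add z A)
  have "(\<Prod>z\<in>#A. [:- z, 1:]) \<noteq> (0 :: 'a poly)" by (auto simp: prod_mset_zero_iff)
  then show ?case using add by (simp add: proots_mult del: mult_pCons_left)
qed simp

text \<open>Equal rook numbers give products of linear factors that agree at every integer, hence
  equal polynomials with equal root multisets. Conversely, equal products have equal coefficients
  with respect to the falling factorials. The common length makes both expansions use the same
  falling factorials.\<close>

lemma rook_equiv_iff_mset_roots:
  assumes m: "m > 0" and B: "ferrers B" "singleton_board m B" and C: "ferrers C" "singleton_board m C"
    and len: "length B = length C"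
  shows "rook_equiv m B C \<longleftrightarrow> mset (root_vec m B) = mset (root_vec m C)"
proof
  assume "rook_equiv m B C"
  then have "(\<Prod>z\<leftarrow>root_vec m B. x - z) = (\<Prod>z\<leftarrow>root_vec m C. x - z)" for x
    unfolding rook_factorization[OF m B] rook_factorization[OF m C] rook_equiv_def len by simp
  moreover have "poly (\<Prod>z\<in>#mset zs. [:- z, 1:]) x = (\<Prod>z\<leftarrow>zs. x - z)" for zs and x :: int
    by (induction zs) (simp_all add: algebra_simps)
  ultimately have "poly (\<Prod>z\<in>#mset (root_vec m B). [:- z, 1:]) = poly (\<Prod>z\<in>#mset (root_vec m C). [:- z, 1:])"
    by (intro ext) simp
  then show "mset (root_vec m B) = mset (root_vec m C)"
    unfolding poly_eq_poly_eq_iff by (metis proots_prod_linear)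
next
  assume eq: "mset (root_vec m B) = mset (root_vec m C)"
  have "(\<Prod>z\<leftarrow>root_vec m B. x - z) = (\<Prod>z\<leftarrow>root_vec m C. x - z)" for x
    using eq by (metis mset_map prod_mset_prod_list)
  then have "(\<Sum>k\<le>length C. int (rook_num m k B) * falling m x (length C - k)) =
      (\<Sum>k\<le>length C. int (rook_num m k C) * falling m x (length C - k))" for x
    unfolding rook_factorization[OF m B] rook_factorization[OF m C] len by simp
  then have "rook_num m k B = rook_num m k C" if "k \<le> length C" for k
    using falling_coeffs_unique[OF m _ that, of "\<lambda>k. int (rook_num m k B)" "\<lambda>k. int (rook_num m k C)"] by simp
  then show "rook_equiv m B C"
    unfolding rook_equiv_def using rook_num_eq_0 len by (metis not_le)
qed

section \<open>Boards and their root words\<close>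

lemma ferrers_replicate_0: "ferrers (replicate d 0 @ B) \<longleftrightarrow> ferrers B"
  unfolding ferrers_def by (induction d) auto

lemma singleton_board_Cons_0: "singleton_board m (0 # B) \<longleftrightarrow> singleton_board m B"
proof
  assume s: "singleton_board m (0 # B)"
  show "singleton_board m B" unfolding singleton_board_def
  proof (intro allI impI)
    fix i assume "i + 1 < length B" "B ! i - floor_m m (B ! i) \<noteq> 0"
    then show "floor_m m (B ! i) < floor_m m (B ! (i + 1))"
      using s[unfolded singleton_board_def, rule_format, of "Suc i"] by simp
  qed
next
  assume s: "singleton_board m B"
  show "singleton_board m (0 # B)" unfolding singleton_board_def
  proof (intro allI impI)
    fix i assume i: "i + 1 < length (0 # B)" "(0 # B) ! i - floor_m m ((0 # B) ! i) \<noteq> 0"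
    then obtain j where j: "i = Suc j" by (cases i) (auto simp: floor_m_def)
    then show "floor_m m ((0 # B) ! i) < floor_m m ((0 # B) ! (i + 1))"
      using s[unfolded singleton_board_def, rule_format, of j] i by simp
  qed
qed

lemma singleton_board_replicate_0: "singleton_board m (replicate d 0 @ B) \<longleftrightarrow> singleton_board m B"
  by (induction d) (simp_all add: singleton_board_Cons_0)

text \<open>Columns are removed on the right, because the recurrence there does not mention the
  number of columns.\<close>

lemma rook_num_Cons_0:
  assumes "m > 0" "ferrers B" "singleton_board m B"
  shows "rook_num m k (0 # B) = rook_num m k B"
  using assms(2,3)
proof (induction B arbitrary: k rule: rev_induct)
  case Nil
  have "cells [0] = cells []" unfolding cells_def by auto
  then show ?case unfolding rook_num_def by simp
next
  case (snoc b B)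
  note IH = snoc.IH[OF sorted_singleton_butlast[OF snoc.prems]]
  show ?case
  proof (cases k)
    case 0
    then show ?thesis by (simp add: rook_num_0)
  next
    case (Suc j)
    have "ferrers ((0 # B) @ [b])" "singleton_board m ((0 # B) @ [b])"
      using snoc.prems ferrers_replicate_0[of 1] singleton_board_Cons_0 by auto
    then have "int (rook_num m (Suc j) ((0 # B) @ [b])) = int (rook_num m (Suc j) (B @ [b]))"
      unfolding rook_num_snoc[OF assms(1) snoc.prems]
      using rook_num_snoc[OF assms(1), of "0 # B" b j] IH by simp
    then show ?thesis using Suc by simp
  qed
qed

lemma rook_num_replicate_0:
  assumes "m > 0" "ferrers B" "singleton_board m B"
  shows "rook_num m k (replicate d 0 @ B) = rook_num m k B"
  by (induction d)
     (simp_all add: rook_num_Cons_0 assms ferrers_replicate_0 singleton_board_replicate_0)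

lemma length_pad: "length B \<le> n \<Longrightarrow> length (pad n B) = n"
  unfolding pad_def by simp

lemma pad_canon: "pad (length B) (canon B) = B"
proof -
  let ?t = "takeWhile (\<lambda>x. x = 0) B"
  have "replicate (length ?t) 0 = ?t"
    by (rule replicate_length_same) (auto dest: set_takeWhileD)
  moreover have "length B - length (canon B) = length ?t"
    unfolding canon_def by (metis add_diff_cancel_right' length_append takeWhile_dropWhile_id)
  ultimately show ?thesis unfolding pad_def canon_def by (metis takeWhile_dropWhile_id)
qed

lemma canon_pad: "canon C = C \<Longrightarrow> canon (pad n C) = C"
  unfolding canon_def pad_def by (simp add: dropWhile_append)

lemma canon_canon: "canon (canon C) = canon C"
  unfolding canon_def by (simp add: dropWhile_idem)

lemma pad_pad: "length B \<le> L \<Longrightarrow> L \<le> n \<Longrightarrow> pad n B = replicate (n - L) 0 @ pad L B"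
  unfolding pad_def by (simp add: replicate_add[symmetric] flip: append_assoc)

section \<open>Passage between boards and root words\<close>

text \<open>Truncated subtraction: this is the root vector only for boards whose root vector is
non-negative, and on those it is an involution, so it also recovers a board from its roots.\<close>

definition roots :: "nat \<Rightarrow> nat list \<Rightarrow> nat list" where
  "roots m P = map (\<lambda>j. m * j - P ! j) [0..<length P]"

text \<open>Used for boards and for words of roots alike; \<open>roots m\<close> exchanges the two
  sides within this region.\<close>

definition below_staircase :: "nat \<Rightarrow> nat list \<Rightarrow> bool" where
  "below_staircase m P \<longleftrightarrow> (\<forall>j<length P. P ! j \<le> m * j)"

lemma length_roots [simp]: "length (roots m P) = length P"
  unfolding roots_def by simp

lemma nth_roots [simp]: "j < length P \<Longrightarrow> roots m P ! j = m * j - P ! j"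
  unfolding roots_def by simp

lemma below_staircase_roots: "below_staircase m (roots m P)"
  unfolding below_staircase_def by simp

lemma roots_roots: "below_staircase m P \<Longrightarrow> roots m (roots m P) = P"
  unfolding below_staircase_def by (intro nth_equalityI) auto

lemma root_vec_eq_roots: "below_staircase m P \<Longrightarrow> root_vec m P = map int (roots m P)"
  unfolding below_staircase_def root_vec_def roots_def by (auto simp: of_nat_diff)

lemma below_staircase_iff: "below_staircase m P \<longleftrightarrow> (\<forall>x\<in>set (root_vec m P). x \<ge> 0)"
  unfolding below_staircase_def root_vec_def by (auto simp flip: of_nat_mult)

text \<open>An entry at most \<open>m * j\<close> has cap at most \<open>m * Suc j\<close>. Hence
  truncation loses nothing when a word is turned back into a board.\<close>

lemma root_word_below_staircase:
  assumes "root_word m w"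
  shows "below_staircase m w"
proof -
  have "w ! j \<le> m * j" if "j < length w" for j
    using that
  proof (induction j)
    case 0
    then show ?case using assms unfolding root_word_def by simp
  next
    case (Suc j)
    then have "w ! j \<le> m * j" by simp
    then have "m * (w ! j div m) \<le> m * j"
      using times_div_less_eq_dividend by (rule order_trans[rotated])
    then have "m * (w ! j div m + 1) \<le> m * Suc j"
      unfolding distrib_left mult_Suc_right by simp
    moreover have "w ! Suc j \<le> m * (w ! j div m + 1)"
      using assms Suc.prems unfolding root_word_def by blast
    ultimately show ?case by (rule order_trans[rotated])
  qed
  then show ?thesis unfolding below_staircase_def by blast
qed

text \<open>Write \<open>a = m * q + r\<close>. For \<open>r = 0\<close> the cap of the root
  \<open>m * j - a\<close> is \<open>m * Suc j - a\<close>, so the bound says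
  \<open>a \<le> b\<close>. For \<open>r > 0\<close> the cap is
  \<open>m * Suc j - m * (q + 1)\<close>, so the bound says that \<open>b\<close> completes the
  level in which \<open>a\<close> ends; this is the singleton condition and implies
  \<open>a \<le> b\<close>.\<close>

lemma root_step_iff:
  fixes a b m j :: nat
  assumes m: "m > 0" and a: "a \<le> m * j" and b: "b \<le> m * Suc j"
  shows "m * Suc j - b \<le> m * ((m * j - a) div m + 1) \<longleftrightarrow>
         a \<le> b \<and> (a - floor_m m a \<noteq> 0 \<longrightarrow> floor_m m a < floor_m m b)"
proof -
  define q r where "q = a div m" and "r = a mod m"
  have a_eq: "a = m * q + r" and r: "r < m" unfolding q_def r_def using m by auto
  have fl: "a - floor_m m a = r" unfolding floor_m_def q_def[symmetric] using a_eq by simp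
  have fl': "floor_m m a < floor_m m b \<longleftrightarrow> m * (q + 1) \<le> b"
  proof -
    have "floor_m m a < floor_m m b \<longleftrightarrow> q + 1 \<le> b div m"
      unfolding floor_m_def q_def[symmetric] using m by auto
    also have "\<dots> \<longleftrightarrow> m * (q + 1) \<le> b"
      using less_eq_div_iff_mult_less_eq[OF m] by (simp only: mult.commute)
    finally show ?thesis .
  qed
  show ?thesis
  proof (cases "r = 0")
    case True
    then have "(m * j - a) div m = j - q" using a_eq m by (simp flip: diff_mult_distrib2)
    moreover have "q \<le> j" using a a_eq True m by simp
    then have "m * (j - q + 1) = m * Suc j - a" using a_eq True by (simp add: algebra_simps)
    ultimately show ?thesis unfolding fl using True a b by auto
  next
    case False
    have "q < j"
    proof (rule ccontr)
      assume "\<not> q < j"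
      then have "m * j \<le> m * q" by simp
      then show False using a a_eq False by linarith
    qed
    then have "m * j - a = m * (j - q - 1) + (m - r)"
    proof -
      obtain d where "j = Suc q + d" using \<open>q < j\<close> less_iff_Suc_add by auto
      then show ?thesis using a_eq r by (simp add: algebra_simps)
    qed
    moreover have "(m * x + (m - r)) div m = x" for x
      by (intro div_nat_eqI) (use False r in auto)
    ultimately have "(m * j - a) div m = j - q - 1" by (simp only:)
    moreover have "m * (j - q - 1 + 1) = m * Suc j - m * (q + 1)"
    proof -
      obtain d where "j = Suc q + d" using \<open>q < j\<close> less_iff_Suc_add by auto
      then show ?thesis by (simp add: algebra_simps)
    qed
    ultimately have "m * Suc j - b \<le> m * ((m * j - a) div m + 1) \<longleftrightarrow>
        m * Suc j - b \<le> m * Suc j - m * (q + 1)"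
      by (simp only:)
    also have "\<dots> \<longleftrightarrow> m * (q + 1) \<le> b"
    proof -
      have "m * (q + 1) \<le> m * Suc j" using \<open>q < j\<close> by (intro mult_le_mono2) simp
      then show ?thesis using b by (intro iffI) linarith+
    qed
    also have "\<dots> \<longleftrightarrow> a \<le> b \<and> m * (q + 1) \<le> b" using a_eq r by auto
    finally show ?thesis unfolding fl fl' using False by simp
  qed
qed

lemma root_word_roots_iff:
  assumes m: "m > 0" and "P \<noteq> []" and P: "below_staircase m P"
  shows "root_word m (roots m P) \<longleftrightarrow> ferrers P \<and> singleton_board m P"
proof -
  have "roots m P ! 0 = 0" using assms(2) by simp
  moreover have "roots m P \<noteq> []" using assms(2) by (metis length_0_conv length_roots)
  ultimately have "root_word m (roots m P) \<longleftrightarrow>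
    (\<forall>p. Suc p < length P \<longrightarrow> m * Suc p - P ! Suc p \<le> m * ((m * p - P ! p) div m + 1))"
    unfolding root_word_def by (simp del: mult_Suc_right)
  also have "\<dots> \<longleftrightarrow> (\<forall>p. Suc p < length P \<longrightarrow> P ! p \<le> P ! Suc p \<and>
      (P ! p - floor_m m (P ! p) \<noteq> 0 \<longrightarrow> floor_m m (P ! p) < floor_m m (P ! Suc p)))"
    using root_step_iff[OF m] P unfolding below_staircase_def by (metis Suc_lessD)
  also have "\<dots> \<longleftrightarrow> ferrers P \<and> singleton_board m P"
    unfolding ferrers_def singleton_board_def sorted_iff_nth_Suc by auto
  finally show ?thesis .
qed

lemma vertex_root_word:
  assumes m: "m > 0" and B: "ferrers B" "singleton_board m B" "B \<noteq> []" "below_staircase m B"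
    and C: "C \<in> rook_graph_vertices m B"
  defines "P \<equiv> pad (length B) C"
  shows "length C \<le> length B" and "below_staircase m P"
    and "root_word m (roots m P)" and "mset (roots m P) = mset (roots m B)" and "canon P = C"
proof -
  let ?n = "length B"
  have C': "ferrers C" "canon C = C" "singleton_board m C" "rook_equiv m C B"
    using C unfolding rook_graph_vertices_def by auto
  \<comment> \<open>The length \<open>L\<close> stays arbitrary, since \<open>C\<close> might still
    be longer than \<open>B\<close>.\<close>
  have eq: "mset (root_vec m (pad L C)) = mset (root_vec m (pad L B))"
    if "length C \<le> L" "?n \<le> L" for L
  proof -
    have "rook_equiv m (pad L C) (pad L B)"
      using C'(4) unfolding rook_equiv_def pad_def
      by (simp add: rook_num_replicate_0[OF m] B C')
    then show ?thesis
      using rook_equiv_iff_mset_roots[OF m, of "pad L C" "pad L B"] length_pad that B C'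
      by (simp add: pad_def ferrers_replicate_0 singleton_board_replicate_0)
  qed
  have below: "below_staircase m (pad L C)" if L: "length C \<le> L" "?n \<le> L" for L
  proof -
    have "below_staircase m (pad L B)"
      unfolding below_staircase_def pad_def
    proof (intro allI impI)
      fix j assume j: "j < length (replicate (L - ?n) 0 @ B)"
      show "(replicate (L - ?n) 0 @ B) ! j \<le> m * j"
      proof (cases "j < L - ?n")
        case False
        then have "B ! (j - (L - ?n)) \<le> m * (j - (L - ?n))"
          using B(4) j unfolding below_staircase_def by simp
        also have "\<dots> \<le> m * j" by simp
        finally show ?thesis using False by (simp add: nth_append)
      qed (simp add: nth_append)
    qed
    then show ?thesis
      unfolding below_staircase_iff using mset_eq_setD[OF eq[OF L]] by simp
  qed
  \<comment> \<open>If \<open>C\<close> were longer than \<open>B\<close>, it would lie below the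
    staircase at its own length. Its first column would then be empty, but a canonical list has no
    leading zero.\<close>
  show len: "length C \<le> ?n"
  proof (rule ccontr)
    assume "\<not> length C \<le> ?n"
    then have "below_staircase m C" "C \<noteq> []" using below[of "length C"] by (auto simp: pad_def)
    then have "C ! 0 = 0" unfolding below_staircase_def by auto
    moreover have "hd C \<noteq> 0"
      using C'(2) \<open>C \<noteq> []\<close> hd_dropWhile[of "\<lambda>x. x = 0" C] unfolding canon_def by simp
    ultimately show False using \<open>C \<noteq> []\<close> by (simp add: hd_conv_nth)
  qed
  show bP: "below_staircase m P" unfolding P_def using below[OF len] by simp
  have lP: "length P = ?n" unfolding P_def using length_pad[OF len] .
  have "P \<noteq> []" using lP B(3) by auto
  moreover have "ferrers P \<and> singleton_board m P"
    using C' unfolding P_def pad_def ferrers_replicate_0 singleton_board_replicate_0 by simp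
  ultimately show "root_word m (roots m P)" using root_word_roots_iff[OF m _ bP] by blast
  have "mset (root_vec m P) = mset (root_vec m B)"
    using eq[OF len] unfolding P_def by (simp add: pad_def)
  then have "image_mset int (mset (roots m P)) = image_mset int (mset (roots m B))"
    unfolding root_vec_eq_roots[OF bP] root_vec_eq_roots[OF B(4)] by simp
  then have "image_mset nat (image_mset int (mset (roots m P))) =
      image_mset nat (image_mset int (mset (roots m B)))" by (rule arg_cong)
  then show "mset (roots m P) = mset (roots m B)"
    unfolding image_mset.compositionality comp_def by simp
  show "canon P = C" unfolding P_def using canon_pad C'(2) by blast
qed

text \<open>The converse passage: each arrangement of the roots of \<open>B\<close> that is a root
  word yields a vertex. Padding restores the columns removed by \<open>canon\<close> because the
  lengths agree.\<close>

lemma root_word_vertex: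
  assumes m: "m > 0" and B: "ferrers B" "singleton_board m B" "below_staircase m B"
    and w: "root_word m w" "mset w = mset (roots m B)"
  shows "canon (roots m w) \<in> rook_graph_vertices m B"
    and "pad (length B) (canon (roots m w)) = roots m w"
proof -
  let ?P = "roots m w" and ?C = "canon (roots m w)"
  have len: "length ?P = length B" using w(2) mset_eq_length by fastforce
  show pad: "pad (length B) ?C = ?P" using pad_canon[of ?P] len by simp
  have ww: "roots m ?P = w" using roots_roots[OF root_word_below_staircase[OF w(1)]] .
  have "w \<noteq> []" using w(1) unfolding root_word_def by simp
  then have "?P \<noteq> []" by (metis length_0_conv length_roots)
  then have P: "ferrers ?P" "singleton_board m ?P"
    using root_word_roots_iff[OF m \<open>?P \<noteq> []\<close> below_staircase_roots] ww w(1) by auto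
  then have C: "ferrers ?C" "singleton_board m ?C"
    using pad unfolding pad_def by (metis ferrers_replicate_0, metis singleton_board_replicate_0)
  have "mset (root_vec m ?P) = mset (root_vec m B)"
    unfolding root_vec_eq_roots[OF below_staircase_roots] root_vec_eq_roots[OF B(3)] ww
    using w(2) by simp
  then have "rook_equiv m ?P B" using rook_equiv_iff_mset_roots[OF m P B(1,2) len] by simp
  then have "rook_equiv m ?C B"
    using rook_num_replicate_0[OF m C] pad unfolding rook_equiv_def pad_def by metis
  then show "?C \<in> rook_graph_vertices m B"
    unfolding rook_graph_vertices_def using C canon_canon by blast
qed

section \<open>Edges of the graph as swaps of roots\<close>

text \<open>The edge relation for lists that already have a common length, so that the amount of
  padding can be changed.\<close>

definition cell_shift :: "nat list \<Rightarrow> nat list \<Rightarrow> bool" where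
  "cell_shift P Q \<longleftrightarrow> (\<exists>i j k. i < length P \<and> j < length P \<and> i \<noteq> j \<and> (k::int) > 0
        \<and> int (P ! i) = int (Q ! i) + k \<and> int (P ! j) = int (Q ! j) - k
        \<and> (\<forall>l<length P. l \<noteq> i \<longrightarrow> l \<noteq> j \<longrightarrow> P ! l = Q ! l))"

lemma cell_shift_Cons: "cell_shift (a # P) (a # Q) \<longleftrightarrow> cell_shift P Q"
proof
  assume "cell_shift (a # P) (a # Q)"
  then obtain i j k where *: "i < Suc (length P)" "j < Suc (length P)" "i \<noteq> j" "(k::int) > 0"
    "int ((a # P) ! i) = int ((a # Q) ! i) + k" "int ((a # P) ! j) = int ((a # Q) ! j) - k"
    "\<forall>l<Suc (length P). l \<noteq> i \<longrightarrow> l \<noteq> j \<longrightarrow> (a # P) ! l = (a # Q) ! l"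
    unfolding cell_shift_def by auto
  \<comment> \<open>The two chosen columns differ in height by \<open>k > 0\<close>, so neither is
    the common first one.\<close>
  obtain i' j' where "i = Suc i'" "j = Suc j'" using *(4-6) by (cases i; cases j) auto
  then show "cell_shift P Q"
    unfolding cell_shift_def using * by (intro exI[of _ i'] exI[of _ j'] exI[of _ k]) auto
next
  assume "cell_shift P Q"
  then obtain i j k where *: "i < length P" "j < length P" "i \<noteq> j" "(k::int) > 0"
    "int (P ! i) = int (Q ! i) + k" "int (P ! j) = int (Q ! j) - k"
    "\<forall>l<length P. l \<noteq> i \<longrightarrow> l \<noteq> j \<longrightarrow> P ! l = Q ! l"
    unfolding cell_shift_def by auto
  then show "cell_shift (a # P) (a # Q)"
    unfolding cell_shift_def
    by (intro exI[of _ "Suc i"] exI[of _ "Suc j"] exI[of _ k]) (auto simp: nth_Cons split: nat.split)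
qed

lemma rook_edge_iff_cell_shift:
  assumes "length x \<le> n" "length y \<le> n"
  shows "rook_edge x y \<longleftrightarrow> cell_shift (pad n x) (pad n y)"
proof -
  let ?L = "max (length x) (length y)"
  have "rook_edge x y \<longleftrightarrow> cell_shift (pad ?L x) (pad ?L y)"
    unfolding rook_edge_def cell_shift_def Let_def length_pad[OF max.cobounded1] ..
  also have "\<dots> \<longleftrightarrow> cell_shift (replicate d 0 @ pad ?L x) (replicate d 0 @ pad ?L y)" for d
    by (induction d) (simp_all add: cell_shift_Cons)
  finally show ?thesis using pad_pad[of x ?L n] pad_pad[of y ?L n] assms by simp
qed

lemma mset_remove_two:
  assumes "i < length w" "j < length w" "i \<noteq> j"
  shows "mset w = {#w ! i, w ! j#} + image_mset ((!) w) (mset_set ({..<length w} - {i, j}))"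
proof -
  have "mset w = image_mset ((!) w) (mset_set {..<length w})"
    by (metis atLeast_upt map_nth mset_map mset_set_set distinct_upt)
  also have "{..<length w} = insert i (insert j ({..<length w} - {i, j}))" using assms by auto
  also have "image_mset ((!) w) (mset_set \<dots>) =
    {#w ! i, w ! j#} + image_mset ((!) w) (mset_set ({..<length w} - {i, j}))"
    using assms(3) by simp
  finally show ?thesis .
qed

text \<open>Cancelling the common entries leaves equal multisets of two values, which must be
  matched crosswise because the entries at \<open>i\<close> differ.\<close>

lemma swapped_if_two_differences:
  assumes ms: "mset w = mset w'" and ij: "i < length w" "j < length w" "i \<noteq> j" and diff: "w ! i \<noteq> w' ! i"
    and rest: "\<And>l. l < length w \<Longrightarrow> l \<noteq> i \<Longrightarrow> l \<noteq> j \<Longrightarrow> w ! l = w' ! l"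
  shows "swapped w w'"
proof -
  have len: "length w = length w'" using ms mset_eq_length by blast
  have "image_mset ((!) w) (mset_set ({..<length w} - {i, j})) =
        image_mset ((!) w') (mset_set ({..<length w} - {i, j}))"
    using rest by (intro image_mset_cong) auto
  then have "{#w ! i, w ! j#} = {#w' ! i, w' ! j#}"
    using mset_remove_two[OF ij] mset_remove_two[of i w' j] ij ms len by (metis add_right_cancel)
  then have sw: "w' ! i = w ! j" "w' ! j = w ! i" using diff by (auto simp: add_eq_conv_ex)
  \<comment> \<open>Covers both orders of \<open>i\<close> and \<open>j\<close>, as
    \<open>swapped\<close> lists the smaller position first.\<close>
  have eq: "w' = w[a := w ! b, b := w ! a]" if "{a, b} = {i, j}" "a \<noteq> b" for a b
    using len rest sw ij that by (intro nth_equalityI) (auto simp: nth_list_update doubleton_eq_iff)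
  show ?thesis
  proof (cases "i < j")
    case True
    then show ?thesis unfolding swapped_def using eq[of i j] ij diff sw by metis
  next
    case False
    then have "j < i" using ij by simp
    moreover have "w' = w[j := w ! i, i := w ! j]" using eq[of j i] ij by (metis insert_commute)
    ultimately show ?thesis unfolding swapped_def using ij diff sw by metis
  qed
qed

lemma swapped_if_cell_shift:
  assumes "cell_shift P Q" "below_staircase m P" "below_staircase m Q"
    and "mset (roots m P) = mset (roots m Q)"
  shows "swapped (roots m P) (roots m Q)"
proof -
  have len: "length P = length Q" using assms(4) mset_eq_length by (metis length_roots)
  obtain i j k where *: "i < length P" "j < length P" "i \<noteq> j" "(k::int) > 0"
    "int (P ! i) = int (Q ! i) + k"
    "\<forall>l<length P. l \<noteq> i \<longrightarrow> l \<noteq> j \<longrightarrow> P ! l = Q ! l"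
    using assms(1) unfolding cell_shift_def by auto
  \<comment> \<open>Below the staircase no truncation occurs, so different heights give different
    roots.\<close>
  have "P ! i \<le> m * i" "Q ! i \<le> m * i" using assms(2,3) *(1) len unfolding below_staircase_def by auto
  then have "roots m P ! i \<noteq> roots m Q ! i" using * len by auto
  then show ?thesis
    using swapped_if_two_differences[OF assms(4), of i j] * len by simp
qed

lemma cell_shift_if_swapped:
  assumes sw: "swapped w w'" and w: "below_staircase m w" "below_staircase m w'"
  shows "cell_shift (roots m w) (roots m w')"
proof -
  obtain a b where ab: "a < b" "b < length w" "w ! a \<noteq> w ! b" "w' = w[a := w ! b, b := w ! a]"
    using sw unfolding swapped_def by blast
  have len: "length w' = length w" using ab by simp
  have r: "int (roots m w ! l) = int (m * l) - int (w ! l)"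
    "int (roots m w' ! l) = int (m * l) - int (w' ! l)" if "l < length w" for l
    using w that len unfolding below_staircase_def by (auto simp: of_nat_diff)
  have nth: "w' ! a = w ! b" "w' ! b = w ! a" "\<And>l. l \<noteq> a \<Longrightarrow> l \<noteq> b \<Longrightarrow> w' ! l = w ! l"
    using ab by auto
  have ra: "int (roots m w ! a) = int (roots m w' ! a) + (int (w ! b) - int (w ! a))"
    and rb: "int (roots m w ! b) = int (roots m w' ! b) - (int (w ! b) - int (w ! a))"
    using r[of a] r[of b] nth ab by simp_all
  have rest: "\<forall>l<length w. l \<noteq> a \<longrightarrow> l \<noteq> b \<longrightarrow> roots m w ! l = roots m w' ! l"
    using nth(3) len by simp
  \<comment> \<open>A smaller root means a higher column: \<open>k\<close> is the difference of the
    swapped roots, and their order decides which position loses cells.\<close>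
  show ?thesis
  proof (cases "w ! a < w ! b")
    case True
    then show ?thesis unfolding cell_shift_def length_roots using ra rb rest ab(1,2)
      by (intro exI[of _ a] exI[of _ b] exI[of _ "int (w ! b) - int (w ! a)"]) auto
  next
    case False
    then show ?thesis unfolding cell_shift_def length_roots using ra rb rest ab(1-3)
      by (intro exI[of _ b] exI[of _ a] exI[of _ "int (w ! a) - int (w ! b)"]) auto
  qed
qed

text \<open>The maps \<open>?f\<close> and \<open>?g\<close> are mutually inverse between the
  vertices and the root words on the multiset \<open>?Z\<close>. They carry edges to swaps and back,
  so paths can be transported either way.\<close>

lemma rook_graph_connected_iff:
  assumes m: "m > 0" and B: "ferrers B" "singleton_board m B" "B \<noteq> []" "below_staircase m B"
  shows "rook_graph_connected m B \<longleftrightarrow> multiples_repeated m (mset (roots m B))"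
proof -
  let ?n = "length B" and ?V = "rook_graph_vertices m B" and ?Z = "mset (roots m B)"
  let ?E = "\<lambda>a b. a \<in> ?V \<and> b \<in> ?V \<and> rook_edge a b"
  let ?f = "\<lambda>C. roots m (pad ?n C)" and ?g = "\<lambda>w. canon (roots m w)"
  note vert = vertex_root_word[OF m B]
  note word = root_word_vertex[OF m B(1,2,4)]
  have f_step: "word_step m (?f x) (?f y)" if "?E x y" for x y
  proof -
    have xy: "x \<in> ?V" "y \<in> ?V" "rook_edge x y" using that by auto
    have "cell_shift (pad ?n x) (pad ?n y)"
      using rook_edge_iff_cell_shift[OF vert(1)[OF xy(1)] vert(1)[OF xy(2)]] xy(3) by simp
    then have "swapped (?f x) (?f y)"
      using swapped_if_cell_shift vert(2,4)[OF xy(1)] vert(2,4)[OF xy(2)] by metis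
    then show ?thesis unfolding word_step_def using vert(3)[OF xy(1)] vert(3)[OF xy(2)] by simp
  qed
  have g_step: "?E (?g u) (?g v)" if "word_step m u v" "mset u = ?Z" for u v
  proof -
    have uv: "root_word m u" "root_word m v" "swapped u v" using that(1) unfolding word_step_def by auto
    have v: "mset v = ?Z" using mset_swapped[OF uv(3)] that(2) by simp
    have "cell_shift (pad ?n (?g u)) (pad ?n (?g v))"
      unfolding word(2)[OF uv(1) that(2)] word(2)[OF uv(2) v]
      using cell_shift_if_swapped[OF uv(3)] root_word_below_staircase uv by blast
    then show ?thesis
      using word(1)[OF uv(1) that(2)] word(1)[OF uv(2) v] rook_edge_iff_cell_shift vert(1) by blast
  qed
  have f_g: "?f (?g w) = w" if "root_word m w" "mset w = ?Z" for w
    using word(2)[OF that] roots_roots[OF root_word_below_staircase[OF that(1)]] by simp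
  have g_f: "?g (?f x) = x" if "x \<in> ?V" for x
    using vert(2,5)[OF that] roots_roots by simp
  show ?thesis
  proof
    assume conn: "rook_graph_connected m B"
    show "multiples_repeated m ?Z"
    proof (rule ccontr)
      assume "\<not> multiples_repeated m ?Z"
      then obtain s y e where s: "m dvd s" "y \<in> set (roots m B)" "s < y" "e \<in> set (roots m B)" "e < s"
        "2 \<le> count ?Z e \<or> \<not> m dvd e" "count ?Z s \<le> 1"
        unfolding multiples_repeated_def by (auto simp: not_le)
      have "root_word m (roots m B)" using root_word_roots_iff[OF m B(3,4)] B by simp
      then obtain u v where uv: "root_word m u" "mset u = ?Z" "root_word m v" "mset v = ?Z"
        "\<not> (word_step m)\<^sup>*\<^sup>* u v"
        using unique_multiple_moves[OF _ m s(1) s(7) s(2-6)] by blast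
      have "?E\<^sup>*\<^sup>* (?g u) (?g v)"
        using conn word(1)[OF uv(1,2)] word(1)[OF uv(3,4)]
        unfolding rook_graph_connected_def Let_def by blast
      then have "(word_step m)\<^sup>*\<^sup>* (?f (?g u)) (?f (?g v))"
        by (induction rule: rtranclp_induct) (auto intro: rtranclp.rtrancl_into_rtrancl f_step)
      then show False using f_g uv by simp
    qed
  next
    assume rep: "multiples_repeated m ?Z"
    show "rook_graph_connected m B"
      unfolding rook_graph_connected_def Let_def
    proof (intro ballI)
      fix x y assume xy: "x \<in> ?V" "y \<in> ?V"
      have "(word_step m)\<^sup>*\<^sup>* (?f x) (?f y)"
        using word_steps_connected[OF vert(3)[OF xy(1)] vert(3)[OF xy(2)] _ m]
          vert(4)[OF xy(1)] vert(4)[OF xy(2)] rep by simp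
      then have "?E\<^sup>*\<^sup>* (?g (?f x)) (?g (?f y))"
      proof (induction rule: rtranclp_induct)
        case (step u v)
        have "mset u = ?Z" using mset_word_steps[OF step.hyps(1)] vert(4)[OF xy(1)] by simp
        then show ?case using g_step[OF step.hyps(2)] step.IH by (simp add: rtranclp.rtrancl_into_rtrancl)
      qed simp
      then show "?E\<^sup>*\<^sup>* x y" using g_f xy by simp
    qed
  qed
qed

theorem theorem21:
  fixes m :: nat and B :: "nat list"
  defines "z \<equiv> root_vec m B"
  defines "v \<equiv> (\<lambda>k::int. length (filter (\<lambda>x. x = k) z))"
  defines "M \<equiv> Max (set z)"
  defines "S \<equiv> {s::int. 0 \<le> s \<and> int m dvd s \<and> s < M}"
  defines "I \<equiv> {i::nat. v (int i) > 1 \<or> (v (int i) = 1 \<and> \<not> m dvd i)}"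
  assumes "m > 0"
    and "ferrers B"
    and "singleton_board m B"
    and "B \<noteq> []"
    and "\<forall>x\<in>set z. x \<ge> 0"
  shows "rook_graph_connected m B \<longleftrightarrow>
         (\<forall>s\<in>S. I \<noteq> {} \<longrightarrow> s > int (LEAST i. i \<in> I) \<longrightarrow> v s \<ge> 2)"
proof -
  let ?w = "roots m B"
  let ?Z = "mset ?w"
  have below: "below_staircase m B" unfolding below_staircase_iff using assms(10) unfolding z_def .
  have z: "z = map int ?w" unfolding z_def by (rule root_vec_eq_roots[OF below])
  have v: "v (int k) = count ?Z k" for k
    unfolding v_def z count_mset count_list_eq_length_filter filter_map length_map
    by (rule arg_cong[of _ _ length], rule filter_cong) auto
  have ne: "?w \<noteq> []" using assms(9) by (metis length_0_conv length_roots)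
  have M: "M = int (Max (set ?w))"
    unfolding M_def z set_map using ne by (intro mono_Max_commute[symmetric]) (auto intro: monoI)
  have I: "i \<in> I \<longleftrightarrow> i \<in># ?Z \<and> (2 \<le> count ?Z i \<or> \<not> m dvd i)" for i
  proof -
    have pos: "i \<in># ?Z \<longleftrightarrow> 1 \<le> count ?Z i" by (simp only: count_greater_eq_one_iff)
    have "n > 1 \<or> n = 1 \<and> D \<longleftrightarrow> 1 \<le> n \<and> (2 \<le> n \<or> D)" for n :: nat and D
      by auto
    then show ?thesis unfolding I_def mem_Collect_eq v pos .
  qed
  have "multiples_repeated m ?Z \<longleftrightarrow>
    (\<forall>s\<in>S. I \<noteq> {} \<longrightarrow> s > int (LEAST i. i \<in> I) \<longrightarrow> v s \<ge> 2)" (is "_ \<longleftrightarrow> ?R")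
  proof
    assume rep: "multiples_repeated m ?Z"
    show ?R
    proof (intro ballI impI)
      fix s assume s: "s \<in> S" "I \<noteq> {}" "int (LEAST i. i \<in> I) < s"
      obtain t where t: "s = int t" using s(1) unfolding S_def by (auto elim: nonneg_int_cases)
      \<comment> \<open>Instantiate \<open>e\<close> with the least element of \<open>I\<close> and
        \<open>y\<close> with the maximum.\<close>
      have "(LEAST i. i \<in> I) \<in> I" using s(2) by (auto intro: LeastI)
      moreover have "m dvd t" "t < Max (set ?w)" "(LEAST i. i \<in> I) < t"
        using s t M unfolding S_def by auto
      moreover have "Max (set ?w) \<in># ?Z" using ne by simp
      ultimately have "2 \<le> count ?Z t" using rep I unfolding multiples_repeated_def by blast
      then show "2 \<le> v s" unfolding t v .
    qed
  next
    assume R: ?R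
    show "multiples_repeated m ?Z"
      unfolding multiples_repeated_def
    proof (intro allI impI, elim conjE)
      fix s y e assume *: "m dvd s" "y \<in># ?Z" "s < y" "e \<in># ?Z" "e < s" "2 \<le> count ?Z e \<or> \<not> m dvd e"
      \<comment> \<open>Any \<open>y\<close> above \<open>s\<close> forces \<open>s < M\<close>, and
        any admissible \<open>e\<close> below \<open>s\<close> shows that \<open>I\<close> is
        nonempty with its least element below \<open>s\<close>.\<close>
      have "y \<le> Max (set ?w)" using *(2) by simp
      then have "int s \<in> S" unfolding S_def M using *(1,3) by simp
      moreover have "e \<in> I" using I * by blast
      then have "I \<noteq> {}" "int (LEAST i. i \<in> I) < int s"
        using Least_le[of "\<lambda>i. i \<in> I" e] *(5) by auto
      ultimately have "2 \<le> v (int s)" using R by blast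
      then show "2 \<le> count ?Z s" unfolding v .
    qed
  qed
  then show ?thesis using rook_graph_connected_iff[OF assms(6-9) below] by simp
qed

end
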